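(* Let $\mathcal{Y}$ be a random edge-labeled network with edges labeled by $\mathbb{N}=\{1,2,\dots\}$ which is edge exchangeable and which is blip-free with probability $1$. Then there exists a probability measure $\phi$ on $\mathcal{F}_1$ such that $\mathcal{Y}\sim\epsilon_\phi$, where $$\epsilon_\phi(\cdot)=\int_{\mathcal{F}_1}\epsilon_f(\cdot)\,\phi(df).$$ That is, $\mathcal{Y}$ can be generated by first sampling $f\sim\phi$ and then, given $f$, setting $\mathcal{Y}=\mathcal{E}_{\mathcal{X}}$ where $\mathcal{X}:\mathbb{N}\to\mathrm{fin}(\mathbb{N})$, $\mathcal{X}(i)=X_i$, with $X_1,X_2,\dots$ i.i.d. satisfying $\mathrm{pr}(X_i=s\mid f)=f_s$ for $s\in\mathrm{fin}(\mathbb{N})$.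
   Context: For a set $\mathcal{P}$, $\mathrm{fin}(\mathcal{P})$ denotes the set of finite ordered multisets of $\mathcal{P}$, i.e. finite sequences $(s_1,\dots,s_r)$ of elements of $\mathcal{P}$. An interaction process is a map $\mathcal{I}:S\to\mathrm{fin}(\mathcal{P})$ with $S\subseteq\mathbb{N}$. A bijection $\rho:\mathcal{P}\to\mathcal{P}'$ acts by $(\rho\mathcal{I})(i)=(\rho(s_1),\dots,\rho(s_r))$ when $\mathcal{I}(i)=(s_1,\dots,s_r)$. The edge-labeled network $\mathcal{E}_{\mathcal{I}}$ induced by $\mathcal{I}$ is the equivalence class of all $\mathcal{I}':S\to\mathrm{fin}(\mathcal{P}')$ (with $\#\mathcal{P}'=\#\mathcal{P}$) such that $\mathcal{I}'=\rho\mathcal{I}$ for some bijection $\rho:\mathcal{P}\to\mathcal{P}'$; i.e. vertex labels are forgotten while edge labels $i\in S$ are kept. $\mathfrak{E}_S$ is the set of such networks with edges labeled in $S$. The restriction $\mathcal{E}|_{S'}$ for $S'\subseteq S$ removes edges with labels outside $S'$; $\mathfrak{E}_{\mathbb{N}}$ carries the Borel $\sigma$-field of the metric $d(\mathcal{E},\mathcal{E}')=1/(1+\sup\{n:\mathcal{E}|_{[n]}=\mathcal{E}'|_{[n]}\})$. For a permutation $\sigma$ of $S$, $\mathcal{E}^\sigma$ is the network induced by $\mathcal{I}^\sigma(i)=\mathcal{I}(\sigma^{-1}(i))$ (edges relabeled). A random $\mathcal{Y}\in\mathfrak{E}_S$ is edge exchangeable if $\mathcal{Y}^\sigma$ and $\mathcal{Y}$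 have the same distribution for all permutations $\sigma:S\to S$. An interaction (a value $s$ of the interaction process, up to vertex relabeling) is a blip if it occurs for exactly one edge label; a network is blip-free if it contains no blips. $\mathcal{F}_1=\{(f_s)_{s\in\mathrm{fin}(\mathbb{N})}: f_s\ge0,\ \sum_s f_s=1\}$, and for $f\in\mathcal{F}_1$, $\epsilon_f$ denotes the distribution of $\mathcal{E}_{\mathcal{X}}$ where $\mathcal{X}(i)=X_i$ with $X_1,X_2,\dots$ i.i.d. with $\mathrm{pr}(X_i=s)=f_s$. *)

theory Defs
  imports "HOL-Probability.Probability"
begin

text \<open>Interaction processes with edge labels in nat (label i here stands for the
paper's label i+1) and vertices in nat.\<close>

type_synonym iproc = "nat \<Rightarrow> nat list"

text \<open>An edge-labeled network is represented by its equivalence class of processes.\<close>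
type_synonym network = "iproc set"

definition verts :: "iproc \<Rightarrow> nat set" where
  "verts I = (\<Union>i. set (I i))"

definition verts_upto :: "nat \<Rightarrow> iproc \<Rightarrow> nat set" where
  "verts_upto n I = (\<Union>i<n. set (I i))"

definition proc_equiv :: "iproc \<Rightarrow> iproc \<Rightarrow> bool" where
  "proc_equiv I J \<longleftrightarrow> (\<exists>\<rho>. inj_on \<rho> (verts I) \<and> (\<forall>i. J i = map \<rho> (I i)))"

definition network_of :: "iproc \<Rightarrow> network" where
  "network_of I = {J. proc_equiv I J}"

definition networks :: "network set" where
  "networks = range network_of"

definition proc_equiv_upto :: "nat \<Rightarrow> iproc \<Rightarrow> iproc \<Rightarrow> bool" where
  "proc_equiv_upto n I J \<longleftrightarrow>
     (\<exists>\<rho>. inj_on \<rho> (verts_upto n I) \<and> (\<forall>i<n. J i = map \<rho> (I i)))"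

definition net_restr_eq :: "nat \<Rightarrow> network \<Rightarrow> network \<Rightarrow> bool" where
  "net_restr_eq n E E' \<longleftrightarrow> (\<exists>I\<in>E. \<exists>J\<in>E'. proc_equiv_upto n I J)"

text \<open>Borel sigma-field of the ultrametric d: generated by its open balls, which are
exactly the cylinders below.\<close>
definition network_measure :: "network measure" where
  "network_measure = sigma networks
     {{E' \<in> networks. net_restr_eq n E E'} | n E. E \<in> networks}"

definition net_relabel :: "(nat \<Rightarrow> nat) \<Rightarrow> network \<Rightarrow> network" where
  "net_relabel \<sigma> E = (\<lambda>I. I \<circ> inv \<sigma>) ` E"

definition edge_exchangeable :: "'a measure \<Rightarrow> ('a \<Rightarrow> network) \<Rightarrow> bool" where
  "edge_exchangeable P Y \<longleftrightarrow>
     (\<forall>\<sigma>. bij \<sigma> \<longrightarrow>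
        distr P network_measure (\<lambda>\<omega>. net_relabel \<sigma> (Y \<omega>)) = distr P network_measure Y)"

definition blip_free_proc :: "iproc \<Rightarrow> bool" where
  "blip_free_proc I \<longleftrightarrow> (\<forall>i. \<exists>j. j \<noteq> i \<and> I j = I i)"

definition blip_free_net :: "network \<Rightarrow> bool" where
  "blip_free_net E \<longleftrightarrow> (\<forall>I\<in>E. blip_free_proc I)"

definition F1 :: "(nat list \<Rightarrow> real) set" where
  "F1 = {f. (\<forall>s. 0 \<le> f s) \<and> (f has_sum 1) UNIV}"

definition F1_measure :: "(nat list \<Rightarrow> real) measure" where
  "F1_measure = restrict_space (PiM UNIV (\<lambda>_. borel)) F1"

definition eps :: "(nat list \<Rightarrow> real) \<Rightarrow> network measure" where
  "eps f = distr (PiM (UNIV :: nat set) (\<lambda>_. measure_pmf (embed_pmf f)))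
                 network_measure network_of"

definition eps_mix :: "(nat list \<Rightarrow> real) measure \<Rightarrow> network measure" where
  "eps_mix \<phi> = measure_of networks (sets network_measure)
                  (\<lambda>A. \<integral>\<^sup>+ f. emeasure (eps f) A \<partial>\<phi>)"

end

theory Submission
  imports Defs
begin

text \<open>
  Label the vertices of the random network in order of appearance, which gives a random process X.
  For a fixed edge i, the indicators of X j = X i are exchangeable in j, so an L2 estimate shows that
  the frequency of every interaction s along the windows of edges from 4 ^ k to 2 * 4 ^ k - 1
  converges almost surely; call the limit f s. The expected limiting frequency of the interactions
  occurring among the first K edges is the probability that edge 0 recurs among the next K edges.
  In the absence of blips this tends to 1, so that f has total mass 1.

  X is not exchangeable and the conditional law of the network given f is not eps f. But eps f depends
  on f only up to relabelling of vertices, and the law of f is still a valid mixing measure: sampling n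
  edges from n disjoint windows and averaging, exchangeability shows that the product of the window
  frequencies charges an event depending on n edges with expectation exactly its probability.
  Passing to the limit by Fatou's lemma, both for the event and for its complement, yields the mixture
  formula.
\<close>

section \<open>Equivalence of processes over a set of edges\<close>

text \<open>Covers both \<open>proc_equiv\<close> and \<open>proc_equiv_upto n\<close>, so that the
  properties of an equivalence relation are proved once.\<close>

definition proc_equiv_on :: "nat set \<Rightarrow> iproc \<Rightarrow> iproc \<Rightarrow> bool" where
  "proc_equiv_on S I J \<longleftrightarrow> (\<exists>\<rho>. inj_on \<rho> (\<Union>i\<in>S. set (I i)) \<and> (\<forall>i\<in>S. J i = map \<rho> (I i)))"

lemma proc_equiv_eq_on: "proc_equiv = proc_equiv_on UNIV"
  by (simp add: fun_eq_iff proc_equiv_def proc_equiv_on_def verts_def)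

lemma proc_equiv_upto_eq_on: "proc_equiv_upto n = proc_equiv_on {..<n}"
  by (simp add: fun_eq_iff proc_equiv_upto_def proc_equiv_on_def verts_upto_def Ball_def)

lemma proc_equiv_on_cong: "(\<And>i. i \<in> S \<Longrightarrow> I i = J i) \<Longrightarrow> proc_equiv_on S I J"
  unfolding proc_equiv_on_def by (rule exI[of _ id]) auto

lemma proc_equiv_on_sym:
  assumes "proc_equiv_on S I J"
  shows "proc_equiv_on S J I"
proof -
  obtain \<rho> where \<rho>: "inj_on \<rho> (\<Union>i\<in>S. set (I i))" "\<And>i. i \<in> S \<Longrightarrow> J i = map \<rho> (I i)"
    using assms unfolding proc_equiv_on_def by auto
  let ?V = "\<Union>i\<in>S. set (I i)"
  have V: "(\<Union>i\<in>S. set (J i)) = \<rho> ` ?V" using \<rho>(2) by auto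
  have "inj_on (inv_into ?V \<rho>) (\<rho> ` ?V)"
    by (rule inj_on_inv_into) simp
  moreover have "I i = map (inv_into ?V \<rho>) (J i)" if "i \<in> S" for i
  proof -
    have "map (inv_into ?V \<rho>) (map \<rho> (I i)) = map id (I i)"
      unfolding map_map
    proof (rule map_cong)
      fix v assume "v \<in> set (I i)"
      then have "v \<in> ?V" using that by blast
      then show "(inv_into ?V \<rho> \<circ> \<rho>) v = id v" using inv_into_f_f[OF \<rho>(1)] by simp
    qed simp
    then show ?thesis using \<rho>(2)[OF that] by simp
  qed
  ultimately show ?thesis unfolding proc_equiv_on_def V by blast
qed

lemma proc_equiv_on_trans:
  assumes "proc_equiv_on S I J" "proc_equiv_on S J K"
  shows "proc_equiv_on S I K"
proof -
  obtain \<rho> where \<rho>: "inj_on \<rho> (\<Union>i\<in>S. set (I i))" "\<And>i. i \<in> S \<Longrightarrow> J i = map \<rho> (I i)"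
    using assms(1) unfolding proc_equiv_on_def by auto
  obtain \<tau> where \<tau>: "inj_on \<tau> (\<Union>i\<in>S. set (J i))" "\<And>i. i \<in> S \<Longrightarrow> K i = map \<tau> (J i)"
    using assms(2) unfolding proc_equiv_on_def by auto
  have V: "(\<Union>i\<in>S. set (J i)) = \<rho> ` (\<Union>i\<in>S. set (I i))" using \<rho>(2) by auto
  have "inj_on (\<tau> \<circ> \<rho>) (\<Union>i\<in>S. set (I i))"
    using \<rho>(1) \<tau>(1) unfolding V by (rule comp_inj_on)
  moreover have "K i = map (\<tau> \<circ> \<rho>) (I i)" if "i \<in> S" for i
    using \<rho>(2)[OF that] \<tau>(2)[OF that] by simp
  ultimately show ?thesis unfolding proc_equiv_on_def by blast
qed

lemma proc_equiv_on_mono: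
  assumes "proc_equiv_on T I J" "S \<subseteq> T"
  shows "proc_equiv_on S I J"
proof -
  obtain \<rho> where \<rho>: "inj_on \<rho> (\<Union>i\<in>T. set (I i))" "\<forall>i\<in>T. J i = map \<rho> (I i)"
    using assms(1) unfolding proc_equiv_on_def by auto
  have "inj_on \<rho> (\<Union>i\<in>S. set (I i))"
    by (rule inj_on_subset[OF \<rho>(1)]) (use assms(2) in auto)
  then show ?thesis unfolding proc_equiv_on_def using \<rho>(2) assms(2) by blast
qed

lemma proc_equiv_on_reindex:
  assumes "proc_equiv_on (\<sigma> ` S) I J"
  shows "proc_equiv_on S (I \<circ> \<sigma>) (J \<circ> \<sigma>)"
  using assms unfolding proc_equiv_on_def by simp

text \<open>Coincidence of two edges survives relabelling of vertices, whereas the value of an edge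
  does not. The recurrence events used below are edge cylinders for this reason.\<close>

lemma proc_equiv_on_same_edge:
  assumes "proc_equiv_on S I J" "i \<in> S" "j \<in> S" "I i = I j"
  shows "J i = J j"
  using assms unfolding proc_equiv_on_def by auto

lemma network_of_eq_iff: "network_of I = network_of J \<longleftrightarrow> proc_equiv_on UNIV I J"
  unfolding network_of_def proc_equiv_eq_on
  by (metis (mono_tags, lifting) Collect_cong mem_Collect_eq proc_equiv_on_cong proc_equiv_on_sym
      proc_equiv_on_trans)

lemma mem_network_of_iff: "J \<in> network_of I \<longleftrightarrow> network_of J = network_of I"
  unfolding network_of_eq_iff using proc_equiv_on_sym
  by (auto simp: network_of_def proc_equiv_eq_on)

text \<open>\<open>net_restr_eq\<close> asks only for some pair of representatives. Any pair will
  do, because equivalence on all edges restricts to the first \<open>n\<close>.\<close>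

lemma net_restr_eq_network_of:
  "net_restr_eq n (network_of I) (network_of J) \<longleftrightarrow> proc_equiv_on {..<n} I J"
proof
  assume "net_restr_eq n (network_of I) (network_of J)"
  then obtain I' J' where "proc_equiv_on UNIV I I'" "proc_equiv_on UNIV J J'" "proc_equiv_on {..<n} I' J'"
    by (auto simp: net_restr_eq_def network_of_def proc_equiv_eq_on proc_equiv_upto_eq_on)
  then show "proc_equiv_on {..<n} I J"
    by (meson proc_equiv_on_mono proc_equiv_on_sym proc_equiv_on_trans subset_UNIV)
next
  assume "proc_equiv_on {..<n} I J"
  then show "net_restr_eq n (network_of I) (network_of J)"
    unfolding net_restr_eq_def proc_equiv_upto_eq_on using mem_network_of_iff by blast
qed

lemma net_relabel_network_of:
  assumes "bij \<sigma>"
  shows "net_relabel \<sigma> (network_of I) = network_of (I \<circ> inv \<sigma>)"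
proof (intro set_eqI iffI)
  have inv: "range (inv \<sigma>) = UNIV" "range \<sigma> = UNIV"
    using assms by (simp_all add: bij_imp_bij_inv bij_is_surj)
  fix J
  show "J \<in> network_of (I \<circ> inv \<sigma>)" if "J \<in> net_relabel \<sigma> (network_of I)"
    using that inv by (auto simp: net_relabel_def network_of_def proc_equiv_eq_on
        intro!: proc_equiv_on_reindex)
  assume "J \<in> network_of (I \<circ> inv \<sigma>)"
  then have "proc_equiv_on (range \<sigma>) (I \<circ> inv \<sigma>) J"
    by (simp add: network_of_def proc_equiv_eq_on inv)
  then have "proc_equiv_on UNIV (I \<circ> inv \<sigma> \<circ> \<sigma>) (J \<circ> \<sigma>)"
    by (rule proc_equiv_on_reindex)
  then have "J \<circ> \<sigma> \<in> network_of I"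
    using assms by (simp add: network_of_def proc_equiv_eq_on comp_assoc bij_is_inj)
  moreover have "J = J \<circ> \<sigma> \<circ> inv \<sigma>"
    using assms by (simp add: comp_assoc surj_iff[THEN iffD1, OF bij_is_surj])
  ultimately show "J \<in> net_relabel \<sigma> (network_of I)"
    unfolding net_relabel_def by blast
qed

section \<open>Events determined by finitely many edges\<close>

text \<open>Such predicates describe exactly the unions of the balls of level \<open>n\<close>. One
  implication is enough because the relation is symmetric.\<close>

definition edge_cylinder :: "nat \<Rightarrow> (iproc \<Rightarrow> bool) \<Rightarrow> bool" where
  "edge_cylinder n Q \<longleftrightarrow> (\<forall>I J. proc_equiv_on {..<n} I J \<longrightarrow> Q I \<longrightarrow> Q J)"

lemma edge_cylinderD: "edge_cylinder n Q \<Longrightarrow> proc_equiv_on {..<n} I J \<Longrightarrow> Q I \<longleftrightarrow> Q J"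
  unfolding edge_cylinder_def using proc_equiv_on_sym by blast

lemma edge_cylinder_cong:
  "edge_cylinder n Q \<Longrightarrow> (\<And>i. i < n \<Longrightarrow> I i = J i) \<Longrightarrow> Q I \<longleftrightarrow> Q J"
  by (rule edge_cylinderD) (auto intro: proc_equiv_on_cong)

lemma edge_cylinder_mono: "edge_cylinder n Q \<Longrightarrow> n \<le> m \<Longrightarrow> edge_cylinder m Q"
  unfolding edge_cylinder_def
  by (meson proc_equiv_on_mono lessThan_subset_iff)

lemma edge_cylinder_not: "edge_cylinder n Q \<Longrightarrow> edge_cylinder n (\<lambda>I. \<not> Q I)"
  unfolding edge_cylinder_def using proc_equiv_on_sym by blast

text \<open>Membership in the image gives some representative satisfying \<open>Q\<close>;
  invariance of \<open>Q\<close> passes this on to every representative.\<close>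

lemma network_of_mem_image_iff:
  assumes "edge_cylinder n Q"
  shows "network_of I \<in> network_of ` Collect Q \<longleftrightarrow> Q I"
  using edge_cylinderD[OF assms proc_equiv_on_mono[OF _ subset_UNIV]]
  by (auto simp: network_of_eq_iff image_iff intro: proc_equiv_on_cong)

lemma space_network_measure [simp]: "space network_measure = networks"
  unfolding network_measure_def by (subst space_measure_of) auto

lemma sets_network_measure:
  "sets network_measure = sigma_sets networks
     {{E' \<in> networks. net_restr_eq n E E'} | n E. E \<in> networks}"
  unfolding network_measure_def by (subst sets_measure_of) auto

text \<open>The set is a union of balls. A ball depends only on the first \<open>n\<close>
  interactions of its centre, and there are countably many such prefixes, so the union is
  countable.\<close>

lemma edge_cylinder_in_sets:
  assumes "edge_cylinder n Q"
  shows "network_of ` Collect Q \<in> sets network_measure"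
proof -
  define cyl where "cyl I = {E' \<in> networks. net_restr_eq n (network_of I) E'}" for I
  have cyl_eq: "cyl I = network_of ` {J. proc_equiv_on {..<n} I J}" for I
    by (auto simp: cyl_def networks_def net_restr_eq_network_of)
  have cyl_cong: "cyl I = cyl J" if "\<And>i. i < n \<Longrightarrow> I i = J i" for I J
  proof -
    have "proc_equiv_on {..<n} I J" using that by (intro proc_equiv_on_cong) auto
    then have "proc_equiv_on {..<n} I = proc_equiv_on {..<n} J"
      using proc_equiv_on_sym proc_equiv_on_trans by (intro ext) blast
    then show ?thesis unfolding cyl_eq by simp
  qed
  have "network_of ` Collect Q = (\<Union>A\<in>cyl ` Collect Q. A)"
  proof -
    have "network_of I \<in> cyl I" for I
      unfolding cyl_eq by (auto intro: proc_equiv_on_cong)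
    moreover have "cyl I \<subseteq> network_of ` Collect Q" if "Q I" for I
      using assms that unfolding cyl_eq edge_cylinder_def by auto
    ultimately show ?thesis by blast
  qed
  moreover have "countable (cyl ` Collect Q)"
  proof (rule countable_subset)
    show "cyl ` Collect Q \<subseteq> range (\<lambda>t :: nat list list. cyl (\<lambda>i. t ! i))"
    proof
      fix A assume "A \<in> cyl ` Collect Q"
      then obtain I where I: "A = cyl I" by auto
      have "cyl I = cyl (\<lambda>i. map I [0..<n] ! i)"
        by (rule cyl_cong) simp
      then show "A \<in> range (\<lambda>t :: nat list list. cyl (\<lambda>i. t ! i))" unfolding I by (rule range_eqI)
    qed
  qed simp
  moreover have "cyl I \<in> sets network_measure" for I
    unfolding sets_network_measure cyl_def networks_def by (rule sigma_sets.Basic) auto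
  ultimately show ?thesis
    using sets.countable_UN'[of "cyl ` Collect Q" "\<lambda>A. A" network_measure] by auto
qed

text \<open>A generator closed under intersections, for uniqueness of measures, and under
  complements, for turning one-sided bounds into equalities.\<close>

definition edge_cylinder_sets :: "network set set" where
  "edge_cylinder_sets = {network_of ` Collect Q | n Q. edge_cylinder n Q}"

lemma edge_cylinder_sets_subset: "edge_cylinder_sets \<subseteq> Pow networks"
  by (auto simp: edge_cylinder_sets_def networks_def)

lemma sets_network_measure_cylinders:
  "sets network_measure = sigma_sets networks edge_cylinder_sets"
proof (rule antisym)
  have "edge_cylinder_sets \<subseteq> sets network_measure"
    unfolding edge_cylinder_sets_def using edge_cylinder_in_sets by auto
  then show "sigma_sets networks edge_cylinder_sets \<subseteq> sets network_measure"
    using sets.sigma_sets_subset[of edge_cylinder_sets network_measure] by simp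
  have "{E' \<in> networks. net_restr_eq n E E'} \<in> edge_cylinder_sets" if E: "E \<in> networks" for n E
  proof -
    obtain I where I: "E = network_of I" using E by (auto simp: networks_def)
    have "edge_cylinder n (proc_equiv_on {..<n} I)"
      unfolding edge_cylinder_def by (blast intro: proc_equiv_on_trans)
    moreover have "{E' \<in> networks. net_restr_eq n E E'} = network_of ` Collect (proc_equiv_on {..<n} I)"
      by (auto simp: I networks_def net_restr_eq_network_of)
    ultimately show ?thesis unfolding edge_cylinder_sets_def by blast
  qed
  then show "sets network_measure \<subseteq> sigma_sets networks edge_cylinder_sets"
    unfolding sets_network_measure by (intro sigma_sets_mono) auto
qed

lemma Int_stable_edge_cylinder_sets: "Int_stable edge_cylinder_sets"
proof (rule Int_stableI)
  fix A B assume "A \<in> edge_cylinder_sets" "B \<in> edge_cylinder_sets"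
  then obtain n Q m R where *: "A = network_of ` Collect Q" "edge_cylinder n Q"
      "B = network_of ` Collect R" "edge_cylinder m R"
    unfolding edge_cylinder_sets_def by blast
  have "edge_cylinder (max n m) (\<lambda>I. Q I \<and> R I)"
    using edge_cylinder_mono[OF *(2), of "max n m"] edge_cylinder_mono[OF *(4), of "max n m"]
    unfolding edge_cylinder_def by auto
  moreover have "A \<inter> B = network_of ` {I. Q I \<and> R I}"
    using network_of_mem_image_iff[OF *(2)] network_of_mem_image_iff[OF *(4)]
    unfolding *(1) *(3) by blast
  ultimately show "A \<inter> B \<in> edge_cylinder_sets"
    unfolding edge_cylinder_sets_def by blast
qed

section \<open>Labelling vertices in order of appearance\<close>

text \<open>The label of \<open>v\<close> when the vertices of \<open>w\<close> are numbered from 0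
  in order of first occurrence.\<close>

definition appearance_rank :: "nat list \<Rightarrow> nat \<Rightarrow> nat" where
  "appearance_rank w v = card (set (takeWhile (\<lambda>u. u \<noteq> v) w))"

text \<open>Ranks are taken in the prefix ending with edge \<open>n\<close>, so that the new
  interaction depends on finitely many edges and becomes measurable in the network.\<close>

definition canonical_proc :: "iproc \<Rightarrow> iproc" where
  "canonical_proc I n = map (appearance_rank (concat (map I [0..<Suc n]))) (I n)"

lemma appearance_rank_append: "v \<in> set w \<Longrightarrow> appearance_rank (w @ w') v = appearance_rank w v"
  unfolding appearance_rank_def by (subst takeWhile_append1) auto

lemma appearance_rank_less:
  assumes "u \<in> set (takeWhile (\<lambda>x. x \<noteq> v) w)"
  shows "appearance_rank w u < appearance_rank w v"
proof -
  let ?T = "\<lambda>v. set (takeWhile (\<lambda>y. y \<noteq> v) w)"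
  have "?T u \<subseteq> ?T v" using assms by (induction w) (auto split: if_splits)
  moreover have "u \<notin> ?T u" by (auto dest: set_takeWhileD)
  ultimately have "?T u \<subset> ?T v" using assms by blast
  then show ?thesis unfolding appearance_rank_def by (intro psubset_card_mono) auto
qed

text \<open>Of two distinct vertices one occurs first. It then lies in the prefix before the other
  and has strictly smaller rank.\<close>

lemma inj_on_appearance_rank: "inj_on (appearance_rank w) (set w)"
proof (rule inj_onI)
  fix u v assume *: "u \<in> set w" "v \<in> set w" "appearance_rank w u = appearance_rank w v"
  have "u = v \<or> u \<in> set (takeWhile (\<lambda>x. x \<noteq> v) w) \<or> v \<in> set (takeWhile (\<lambda>x. x \<noteq> u) w)"
    using *(1,2) by (induction w) auto
  then show "u = v" using *(3) appearance_rank_less[of u v w] appearance_rank_less[of v u w] by auto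
qed

lemma appearance_rank_map:
  assumes "inj_on \<tau> (set w)" "v \<in> set w"
  shows "appearance_rank (map \<tau> w) (\<tau> v) = appearance_rank w v"
proof -
  have "takeWhile (\<lambda>u. u \<noteq> \<tau> v) (map \<tau> w) = map \<tau> (takeWhile (\<lambda>u. u \<noteq> v) w)"
    unfolding takeWhile_map comp_def using assms
    by (intro arg_cong[of _ _ "map \<tau>"] takeWhile_cong) (auto dest: inj_onD)
  moreover have "inj_on \<tau> (set (takeWhile (\<lambda>u. u \<noteq> v) w))"
    by (rule inj_on_subset[OF assms(1)]) (auto dest: set_takeWhileD)
  ultimately show ?thesis unfolding appearance_rank_def by (simp add: card_image)
qed

lemma canonical_proc_cong:
  assumes "proc_equiv_on {..n} I J"
  shows "canonical_proc J n = canonical_proc I n"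
proof -
  obtain \<rho> where \<rho>: "inj_on \<rho> (\<Union>i\<in>{..n}. set (I i))" "\<And>i. i \<le> n \<Longrightarrow> J i = map \<rho> (I i)"
    using assms unfolding proc_equiv_on_def by auto
  let ?w = "concat (map I [0..<Suc n])"
  have "map J [0..<Suc n] = map (\<lambda>i. map \<rho> (I i)) [0..<Suc n]"
    by (rule map_cong) (auto simp: \<rho>(2) simp del: upt_Suc)
  then have w: "concat (map J [0..<Suc n]) = map \<rho> ?w" by (simp only: map_concat map_map comp_def)
  have "set ?w = (\<Union>i\<in>{..n}. set (I i))" 
    by (auto simp del: upt_Suc simp: less_Suc_eq_le)
  then have inj: "inj_on \<rho> (set ?w)" using \<rho>(1) by simp
  have "appearance_rank (map \<rho> ?w) (\<rho> v) = appearance_rank ?w v" if "v \<in> set (I n)" for v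
    by (rule appearance_rank_map[OF inj]) (use that in auto)
  then show ?thesis
    unfolding canonical_proc_def w \<rho>(2)[OF order_refl] map_map
    by (intro map_cong) (simp_all only: comp_apply)
qed

text \<open>One injection has to serve all edges. It takes the rank of a vertex in the prefix ending
  with the first edge containing it; longer prefixes give the same rank.\<close>

lemma canonical_proc_equiv: "proc_equiv_on UNIV I (canonical_proc I)"
proof -
  let ?w = "\<lambda>n. concat (map I [0..<n])"
  have mem: "v \<in> set (?w n)" if "v \<in> set (I i)" "i < n" for i n v
    using that by (auto simp del: upt_Suc)
  have rank: "appearance_rank (?w n) v = appearance_rank (?w m) v" if "v \<in> set (?w m)" "m \<le> n" for m n v
  proof -
    have "?w n = ?w m @ concat (map I [m..<n])"
      using upt_add_eq_append[of 0 m "n - m"] that(2) by simp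
    then show ?thesis using appearance_rank_append[OF that(1)] by simp
  qed
  define \<rho> where "\<rho> v = appearance_rank (?w (Suc (LEAST i. v \<in> set (I i)))) v" for v
  have \<rho>: "\<rho> v = appearance_rank (?w n) v" if "v \<in> set (I i)" "i < n" for i n v
  proof -
    let ?l = "LEAST i. v \<in> set (I i)"
    have "v \<in> set (I ?l)" "?l \<le> i" using that(1) by (rule LeastI, rule Least_le)
    then show ?thesis
      unfolding \<rho>_def using rank[OF mem[of v ?l "Suc ?l"], of n] that(2) by simp
  qed
  have "inj_on \<rho> (\<Union>i. set (I i))"
  proof (rule inj_onI)
    fix u v assume "u \<in> (\<Union>i. set (I i))" "v \<in> (\<Union>i. set (I i))" and eq: "\<rho> u = \<rho> v"
    then obtain i j where ij: "u \<in> set (I i)" "v \<in> set (I j)" by auto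
    let ?n = "Suc (max i j)"
    have "u \<in> set (?w ?n)" "v \<in> set (?w ?n)"
      by (rule mem[OF ij(1)], simp, rule mem[OF ij(2)], simp)
    moreover have "appearance_rank (?w ?n) u = appearance_rank (?w ?n) v"
      using eq \<rho>[OF ij(1), of ?n] \<rho>[OF ij(2), of ?n] by (simp del: upt_Suc)
    ultimately show "u = v" by (meson inj_onD inj_on_appearance_rank)
  qed
  moreover have "canonical_proc I n = map \<rho> (I n)" for n
    unfolding canonical_proc_def using \<rho>[of _ n "Suc n"] by (auto simp del: upt_Suc)
  ultimately show ?thesis unfolding proc_equiv_on_def by blast
qed

lemma ex_bij_extension:
  fixes j :: "nat \<Rightarrow> nat"
  assumes "inj_on j {..<n}"
  shows "\<exists>\<sigma>. bij \<sigma> \<and> (\<forall>i<n. \<sigma> i = j i)"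
proof -
  let ?A = "{..<n}" and ?U = "{..<n} \<union> j ` {..<n}"
  have "card (?U - ?A) = card (?U - j ` ?A)"
    using assms by (simp add: card_Diff_subset card_image)
  then obtain h where h: "bij_betw h (?U - ?A) (?U - j ` ?A)"
    using finite_same_card_bij[of "?U - ?A" "?U - j ` ?A"] by auto
  define \<sigma> where "\<sigma> i = (if i \<in> ?A then j i else if i \<in> ?U then h i else i)" for i
  have "bij_betw \<sigma> ?A (j ` ?A)"
    using assms by (intro bij_betw_imageI) (auto simp: \<sigma>_def inj_on_def)
  moreover have "bij_betw \<sigma> (?U - ?A) (?U - j ` ?A)"
    using h by (rule iffD1[OF bij_betw_cong, rotated]) (auto simp: \<sigma>_def)
  ultimately have "bij_betw \<sigma> (?A \<union> (?U - ?A)) (j ` ?A \<union> (?U - j ` ?A))"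
    by (rule bij_betw_combine) auto
  moreover have "bij_betw \<sigma> (- ?U) (- ?U)"
    using bij_betw_id by (rule iffD1[OF bij_betw_cong, rotated]) (auto simp: \<sigma>_def)
  ultimately have "bij_betw \<sigma> ((?A \<union> (?U - ?A)) \<union> (- ?U)) ((j ` ?A \<union> (?U - j ` ?A)) \<union> (- ?U))"
    by (rule bij_betw_combine) auto
  moreover have "(?A \<union> (?U - ?A)) \<union> (- ?U) = UNIV" "(j ` ?A \<union> (?U - j ` ?A)) \<union> (- ?U) = UNIV"
    by blast+
  ultimately have "bij \<sigma>" by simp
  moreover have "\<forall>i<n. \<sigma> i = j i" by (simp add: \<sigma>_def)
  ultimately show ?thesis by blast
qed

section \<open>The laws of networks with independent edges\<close>

lemma borel_measurable_nn_integral_count_space: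
  fixes f :: "'i \<Rightarrow> 'a \<Rightarrow> ennreal"
  assumes "countable I" "\<And>i. i \<in> I \<Longrightarrow> f i \<in> borel_measurable M"
  shows "(\<lambda>x. \<integral>\<^sup>+i. f i x \<partial>count_space I) \<in> borel_measurable M"
proof -
  interpret sigma_finite_measure "count_space I"
    using assms(1) by (rule sigma_finite_measure_count_space_countable)
  have "(\<lambda>z. f (snd z) (fst z)) \<in> borel_measurable (M \<Otimes>\<^sub>M count_space I)"
    by (rule measurable_compose_countable'[where g=snd and I=I]) (use assms in auto)
  then show ?thesis
    by (intro borel_measurable_nn_integral) (simp add: case_prod_beta')
qed

text \<open>Extensional functions represent each prefix of length \<open>n\<close> exactly once, so
  sums over this set count nothing twice.\<close>

definition cylinder_prefixes :: "nat \<Rightarrow> (iproc \<Rightarrow> bool) \<Rightarrow> iproc set" where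
  "cylinder_prefixes n Q = {t \<in> {..<n} \<rightarrow>\<^sub>E UNIV. Q t}"

lemma countable_cylinder_prefixes: "countable (cylinder_prefixes n Q)"
proof (rule countable_subset)
  show "countable ({..<n} \<rightarrow>\<^sub>E (UNIV :: nat list set))"
    by (rule countable_PiE) auto
qed (auto simp: cylinder_prefixes_def)

lemma restrict_mem_cylinder_prefixes_iff:
  assumes "edge_cylinder n Q"
  shows "restrict I {..<n} \<in> cylinder_prefixes n Q \<longleftrightarrow> Q I"
proof -
  have "Q (restrict I {..<n}) \<longleftrightarrow> Q I"
    by (rule edge_cylinder_cong[OF assms]) simp
  then show ?thesis unfolding cylinder_prefixes_def by simp
qed

lemma edge_cylinder_eq_Union:
  assumes "edge_cylinder n Q"
  shows "Q I \<longleftrightarrow> (\<exists>t\<in>cylinder_prefixes n Q. \<forall>i<n. I i = t i)"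
proof
  assume "Q I"
  then show "\<exists>t\<in>cylinder_prefixes n Q. \<forall>i<n. I i = t i"
    by (intro bexI[of _ "restrict I {..<n}"])
      (simp_all add: restrict_mem_cylinder_prefixes_iff[OF assms])
next
  assume "\<exists>t\<in>cylinder_prefixes n Q. \<forall>i<n. I i = t i"
  then obtain t where t: "Q t" "\<And>i. i < n \<Longrightarrow> I i = t i"
    unfolding cylinder_prefixes_def by blast
  show "Q I" using edge_cylinder_cong[OF assms, of I t] t by simp
qed

text \<open>The event splits into countably many disjoint boxes, each fixing the first
  \<open>n\<close> coordinates and having product measure.\<close>

lemma emeasure_iid_cylinder:
  assumes "edge_cylinder n Q"
  shows "{I. Q I} \<in> sets (PiM UNIV (\<lambda>_. measure_pmf p))" (is ?thesis1)
    and "emeasure (PiM UNIV (\<lambda>_. measure_pmf p)) {I. Q I} =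
      (\<integral>\<^sup>+t. (\<Prod>i<n. ennreal (pmf p (t i))) \<partial>count_space (cylinder_prefixes n Q))" (is ?thesis2)
proof -
  let ?M = "PiM UNIV (\<lambda>_ :: nat. measure_pmf p)"
  define box where "box t = prod_emb UNIV (\<lambda>_ :: nat. measure_pmf p) {..<n} (PiE {..<n} (\<lambda>i. {t i}))"
    for t :: iproc
  have box: "box t = {I. \<forall>i<n. I i = t i}" for t
    unfolding box_def set_eq_iff prod_emb_iff restrict_PiE_iff by (simp add: Ball_def)
  have sets: "box t \<in> sets ?M" for t
    unfolding box_def by (rule sets_PiM_I) auto
  have Q: "{I. Q I} = (\<Union>t\<in>cylinder_prefixes n Q. box t)"
    unfolding box using edge_cylinder_eq_Union[OF assms] by auto
  show ?thesis1
    unfolding Q by (intro sets.countable_UN' countable_cylinder_prefixes) (use sets in auto)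
  have disj: "disjoint_family_on box (cylinder_prefixes n Q)"
    unfolding disjoint_family_on_def
  proof (intro ballI impI)
    fix s t assume "s \<in> cylinder_prefixes n Q" "t \<in> cylinder_prefixes n Q" "s \<noteq> t"
    then obtain i where "i < n" "s i \<noteq> t i"
      unfolding cylinder_prefixes_def by (metis (no_types, lifting) PiE_ext lessThan_iff mem_Collect_eq)
    then show "box s \<inter> box t = {}" unfolding box by auto
  qed
  have "emeasure ?M (box t) = (\<Prod>i<n. ennreal (pmf p (t i)))" for t
    unfolding box_def
    by (subst emeasure_PiM_emb) (auto simp: emeasure_pmf_single measure_pmf.prob_space_axioms)
  then show ?thesis2
    unfolding Q by (subst emeasure_UN_countable) (use sets disj countable_cylinder_prefixes in auto)
qed

lemma network_of_measurable_iid: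
  "network_of \<in> PiM UNIV (\<lambda>_. measure_pmf p) \<rightarrow>\<^sub>M network_measure"
proof (rule measurable_sigma_sets[OF sets_network_measure_cylinders edge_cylinder_sets_subset])
  fix A assume "A \<in> edge_cylinder_sets"
  then obtain n Q where A: "A = network_of ` Collect Q" "edge_cylinder n Q"
    unfolding edge_cylinder_sets_def by blast
  have "network_of -` A \<inter> space (PiM UNIV (\<lambda>_. measure_pmf p)) = {I. Q I}"
    unfolding A(1) using network_of_mem_image_iff[OF A(2)] by (auto simp: space_PiM)
  then show "network_of -` A \<inter> space (PiM UNIV (\<lambda>_. measure_pmf p)) \<in> sets (PiM UNIV (\<lambda>_. measure_pmf p))"
    using emeasure_iid_cylinder(1)[OF A(2)] by simp
qed (auto simp: networks_def)

text \<open>Replaces the unconditional sum by an integral over counting measure, the form suited to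
  \<open>embed_pmf\<close> and to Fatou's lemma.\<close>

lemma F1_iff: "f \<in> F1 \<longleftrightarrow> (\<forall>s. 0 \<le> f s) \<and> (\<integral>\<^sup>+s. ennreal (f s) \<partial>count_space UNIV) = 1"
proof (intro iffI conjI; (elim conjE)?)
  assume f: "f \<in> F1"
  then show nonneg: "\<forall>s. 0 \<le> f s" by (simp add: F1_def)
  have sum: "(f has_sum 1) UNIV" using f by (simp add: F1_def)
  then have "f summable_on UNIV" by (auto simp: summable_on_def)
  then have *: "Infinite_Set_Sum.abs_summable_on f UNIV"
    unfolding abs_summable_equivalent[symmetric]
    by (rule iffD1[OF summable_on_iff_abs_summable_on_real])
  have "infsetsum f UNIV = 1"
    using infsetsum_infsum[OF *] infsumI[OF sum] by simp
  then show "(\<integral>\<^sup>+s. ennreal (f s) \<partial>count_space UNIV) = 1"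
    using nn_integral_conv_infsetsum[OF *] nonneg by simp
next
  assume f: "\<forall>s. 0 \<le> f s" "(\<integral>\<^sup>+s. ennreal (f s) \<partial>count_space UNIV) = 1"
  have p: "pmf (embed_pmf f) = f"
    by (rule ext, rule pmf_embed_pmf) (use f in auto)
  have *: "Infinite_Set_Sum.abs_summable_on f UNIV" "infsetsum f UNIV = 1"
    using pmf_abs_summable[of "embed_pmf f" UNIV] infsetsum_pmf_eq_1[of "embed_pmf f" UNIV]
    unfolding p by auto
  then have "f summable_on UNIV"
    using abs_summable_equivalent abs_summable_summable by blast
  then have "(f has_sum 1) UNIV"
    using has_sum_infsum infsetsum_infsum[OF *(1)] *(2) by metis
  then show "f \<in> F1" using f(1) by (simp add: F1_def)
qed

lemma pmf_embed_pmf_F1: "f \<in> F1 \<Longrightarrow> pmf (embed_pmf f) s = f s"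
  by (rule pmf_embed_pmf) (auto simp: F1_iff)

text \<open>Here \<open>f\<close> enters only through a countable sum of finite products, which
  yields measurability in \<open>f\<close> and lower semicontinuity under pointwise limits.\<close>

lemma emeasure_eps_cylinder:
  assumes "edge_cylinder n Q" "f \<in> F1"
  shows "emeasure (eps f) (network_of ` Collect Q) =
    (\<integral>\<^sup>+t. (\<Prod>i<n. ennreal (f (t i))) \<partial>count_space (cylinder_prefixes n Q))"
proof -
  let ?M = "PiM UNIV (\<lambda>_ :: nat. measure_pmf (embed_pmf f))"
  have "network_of -` (network_of ` Collect Q) \<inter> space ?M = {I. Q I}"
    using network_of_mem_image_iff[OF assms(1)] by (auto simp: space_PiM)
  then show ?thesis
    unfolding eps_def
    by (subst emeasure_distr[OF network_of_measurable_iid edge_cylinder_in_sets[OF assms(1)]])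
       (simp add: emeasure_iid_cylinder(2)[OF assms(1)] pmf_embed_pmf_F1[OF assms(2)])
qed

lemma prob_space_eps: "prob_space (eps f)"
  unfolding eps_def
  by (intro prob_space.prob_space_distr network_of_measurable_iid prob_space_PiM
      measure_pmf.prob_space_axioms)

lemma space_F1_measure [simp]: "space F1_measure = F1"
  by (simp add: F1_measure_def space_restrict_space space_PiM)

lemma eps_measurable: "eps \<in> F1_measure \<rightarrow>\<^sub>M prob_algebra network_measure"
proof (rule measurable_prob_algebra_generated[OF sets_network_measure_cylinders
      Int_stable_edge_cylinder_sets edge_cylinder_sets_subset])
  fix A assume "A \<in> edge_cylinder_sets"
  then obtain n Q where A: "A = network_of ` Collect Q" "edge_cylinder n Q"
    unfolding edge_cylinder_sets_def by blast
  have comp: "(\<lambda>f. f s) \<in> borel_measurable F1_measure" for s :: "nat list"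
    unfolding F1_measure_def by (intro measurable_restrict_space1 measurable_component_singleton) simp
  have "(\<lambda>f. \<integral>\<^sup>+t. (\<Prod>i<n. ennreal (f (t i))) \<partial>count_space (cylinder_prefixes n Q)) \<in> borel_measurable F1_measure"
    using comp by (intro borel_measurable_nn_integral_count_space countable_cylinder_prefixes) measurable
  then show "(\<lambda>f. emeasure (eps f) A) \<in> borel_measurable F1_measure"
    unfolding A(1) by (subst measurable_cong[OF emeasure_eps_cylinder[OF A(2)]]) auto
qed (use prob_space_eps in \<open>auto simp: eps_def\<close>)

text \<open>\<open>eps_mix\<close> applies \<open>measure_of\<close> to a set function not yet known
  to be countably additive. Identifying it with the monadic bind of the kernel \<open>eps\<close>
  settles this.\<close>

lemma eps_mix_eq_bind:
  assumes "prob_space \<phi>" "sets \<phi> = sets F1_measure"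
  shows "eps_mix \<phi> = \<phi> \<bind> eps"
proof -
  interpret \<phi>: prob_space \<phi> by fact
  have meas: "eps \<in> \<phi> \<rightarrow>\<^sub>M subprob_algebra network_measure"
    using measurable_prob_algebraD[OF eps_measurable] assms(2)
    by (simp cong: measurable_cong_sets)
  have sets: "sets (\<phi> \<bind> eps) = sets network_measure"
    by (rule sets_bind[OF sets_kernel[OF meas] \<phi>.not_empty])
  then have space: "space (\<phi> \<bind> eps) = networks"
    using sets_eq_imp_space_eq[OF sets] by simp
  have "eps_mix \<phi> = measure_of networks (sets network_measure) (emeasure (\<phi> \<bind> eps))"
    unfolding eps_mix_def
  proof (rule measure_of_eq)
    show "sets network_measure \<subseteq> Pow networks"
      using sets.space_closed[of network_measure] by simp
    fix A assume "A \<in> sigma_sets networks (sets network_measure)"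
    then have "A \<in> sets network_measure"
      using sets.sigma_sets_eq[of network_measure] by simp
    then show "(\<integral>\<^sup>+f. emeasure (eps f) A \<partial>\<phi>) = emeasure (\<phi> \<bind> eps) A"
      using emeasure_bind[OF \<phi>.not_empty meas] by simp
  qed
  also have "\<dots> = \<phi> \<bind> eps"
    using measure_of_of_measure[of "\<phi> \<bind> eps"] by (simp add: sets space)
  finally show ?thesis .
qed

section \<open>Empirical frequencies along disjoint windows\<close>

text \<open>Disjoint blocks of size \<open>4 ^ k\<close>: the mean square change of a frequency is
  of order \<open>4 ^ (-k)\<close>, so its root is summable. The block also starts beyond
  \<open>k\<close>, which keeps any fixed edge out of all late windows.\<close>

definition window :: "nat \<Rightarrow> nat set" where
  "window k = {4 ^ k..<2 * 4 ^ k}"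

lemma finite_window [simp]: "finite (window k)"
  and card_window [simp]: "card (window k) = 4 ^ k"
  and window_nonempty [simp]: "window k \<noteq> {}"
  by (auto simp: window_def)

lemma window_disjoint:
  assumes "k < l"
  shows "window k \<inter> window l = {}"
proof -
  have "(4::nat) ^ Suc k \<le> 4 ^ l" using assms by (intro power_increasing) auto
  then have "2 * (4::nat) ^ k \<le> 4 ^ l" by simp
  then show ?thesis by (auto simp: window_def)
qed

lemma less_window:
  assumes "i \<le> k" "j \<in> window k"
  shows "i < j"
proof -
  have "k < 4 ^ k" by (rule power_gt_expt) simp
  then show ?thesis using assms by (simp add: window_def)
qed

text \<open>Written as the mass function of the image of a uniform distribution, so that
  nonnegativity, the bound 1 and total mass 1 are inherited.\<close>

definition freq :: "nat \<Rightarrow> iproc \<Rightarrow> nat list \<Rightarrow> real" where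
  "freq k I = pmf (map_pmf I (pmf_of_set (window k)))"

lemma freq_eq: "freq k I s = (\<Sum>j\<in>window k. of_bool (I j = s)) / 4 ^ k"
proof -
  have "(\<Sum>j\<in>window k. of_bool (I j = s)) = real (card (window k \<inter> I -` {s}))"
    by (subst sum_of_bool_eq) (auto intro!: arg_cong[of _ _ card])
  then show ?thesis
    by (simp add: freq_def pmf_map measure_pmf_of_set)
qed

lemma sum_freq_eq:
  assumes "finite S"
  shows "(\<Sum>s\<in>S. freq k I s) = (\<Sum>j\<in>window k. of_bool (I j \<in> S)) / 4 ^ k"
proof -
  have "(\<Sum>j\<in>window k. of_bool (I j \<in> S)) = real (card (window k \<inter> I -` S))"
    by (subst sum_of_bool_eq) (auto intro!: arg_cong[of _ _ card])
  then have "measure (map_pmf I (pmf_of_set (window k))) S = (\<Sum>j\<in>window k. of_bool (I j \<in> S)) / 4 ^ k"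
    by (simp add: measure_map_pmf measure_pmf_of_set)
  then show ?thesis
    unfolding freq_def using measure_measure_pmf_finite[OF assms] by metis
qed

lemma freq_nonneg: "0 \<le> freq k I s"
  by (simp add: freq_def)

lemma nn_integral_freq: "(\<integral>\<^sup>+s. ennreal (freq k I s) \<partial>count_space UNIV) = 1"
  unfolding freq_def by (rule nn_integral_pmf_eq_1) 

text \<open>After expanding the square, the constant correlation \<open>q\<close> is multiplied by
  the squared sum of the weights, which is 0. Only the diagonal survives.\<close>

lemma (in prob_space) expectation_square_weighted_sum:
  fixes Z :: "'i \<Rightarrow> 'a \<Rightarrow> real"
  assumes fin: "finite U" and meas: "\<And>j. j \<in> U \<Longrightarrow> Z j \<in> borel_measurable M"
    and bdd: "\<And>j \<omega>. j \<in> U \<Longrightarrow> \<bar>Z j \<omega>\<bar> \<le> 1"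
    and corr: "\<And>j k. j \<in> U \<Longrightarrow> k \<in> U \<Longrightarrow>
      expectation (\<lambda>\<omega>. Z j \<omega> * Z k \<omega>) = q + (if j = k then d else 0)"
    and c: "(\<Sum>j\<in>U. c j) = 0"
  shows "expectation (\<lambda>\<omega>. (\<Sum>j\<in>U. c j * Z j \<omega>)\<^sup>2) = d * (\<Sum>j\<in>U. (c j)\<^sup>2)"
proof -
  have int: "integrable M (\<lambda>\<omega>. Z j \<omega> * Z k \<omega>)" if "j \<in> U" "k \<in> U" for j k
    using that meas by (intro integrable_const_bound[of _ 1])
      (auto simp: abs_mult intro!: mult_le_one bdd AE_I2)
  have "expectation (\<lambda>\<omega>. (\<Sum>j\<in>U. c j * Z j \<omega>)\<^sup>2)
      = expectation (\<lambda>\<omega>. \<Sum>j\<in>U. \<Sum>k\<in>U. (c j * c k) * (Z j \<omega> * Z k \<omega>))"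
    by (simp add: power2_eq_square sum_product algebra_simps)
  also have "\<dots> = (\<Sum>j\<in>U. \<Sum>k\<in>U. (c j * c k) * expectation (\<lambda>\<omega>. Z j \<omega> * Z k \<omega>))"
    using int by (simp add: Bochner_Integration.integral_sum)
  also have "\<dots> = (\<Sum>j\<in>U. \<Sum>k\<in>U. (c j * c k) * q + (if j = k then d * (c j)\<^sup>2 else 0))"
    using corr by (intro sum.cong refl) (auto simp: algebra_simps power2_eq_square)
  also have "\<dots> = (\<Sum>j\<in>U. c j) * (\<Sum>k\<in>U. c k) * q + (\<Sum>j\<in>U. d * (c j)\<^sup>2)"
    using fin by (simp add: sum.distrib sum_product) (simp add: sum_distrib_right)
  finally show ?thesis using c by (simp add: sum_distrib_left)
qed

section \<open>Exchangeable blip-free networks\<close>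

locale blip_free_exchangeable_network = prob_space P for P :: "'a measure" +
  fixes Y :: "'a \<Rightarrow> network"
  assumes Y_measurable: "Y \<in> P \<rightarrow>\<^sub>M network_measure"
    and exchangeable: "edge_exchangeable P Y"
    and blip_free: "AE \<omega> in P. blip_free_net (Y \<omega>)"
begin

section \<open>A canonical random process and its invariance under sampling of edges\<close>

text \<open>The representative chosen by \<open>SOME\<close> is arbitrary;
  \<open>canonical_proc\<close> erases this choice and makes every coordinate a function of the
  network.\<close>

definition X :: "'a \<Rightarrow> iproc" where
  "X \<omega> = canonical_proc (SOME I. I \<in> Y \<omega>)"

lemma network_of_X:
  assumes "\<omega> \<in> space P"
  shows "network_of (X \<omega>) = Y \<omega>"
proof -
  obtain I where I: "Y \<omega> = network_of I"
    using measurable_space[OF Y_measurable assms] by (auto simp: networks_def)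
  let ?I = "SOME I. I \<in> Y \<omega>"
  have "?I \<in> Y \<omega>" by (rule someI[of _ I]) (simp add: I mem_network_of_iff)
  then have "network_of ?I = Y \<omega>" by (simp add: I mem_network_of_iff)
  then show ?thesis
    using canonical_proc_equiv[of ?I] by (simp add: X_def flip: network_of_eq_iff)
qed

lemma vimage_edge_cylinder:
  assumes "edge_cylinder n Q"
  shows "Y -` (network_of ` Collect Q) \<inter> space P = {\<omega> \<in> space P. Q (X \<omega>)}"
proof -
  have "Y \<omega> \<in> network_of ` Collect Q \<longleftrightarrow> Q (X \<omega>)" if "\<omega> \<in> space P" for \<omega>
    using network_of_mem_image_iff[OF assms, of "X \<omega>"] network_of_X[OF that] by simp
  then show ?thesis by blast
qed

text \<open>Canonical labelling is idempotent, and its value at \<open>i\<close> depends only on the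
  class of the first \<open>Suc i\<close> edges. Hence fixing a coordinate is the preimage of an
  edge cylinder.\<close>

lemma X_measurable [measurable]: "(\<lambda>\<omega>. X \<omega> i) \<in> P \<rightarrow>\<^sub>M count_space UNIV"
proof (subst measurable_count_space_eq2_countable, safe)
  fix s :: "nat list"
  let ?Q = "\<lambda>I. canonical_proc I i = s"
  have "edge_cylinder (Suc i) ?Q"
    unfolding edge_cylinder_def lessThan_Suc_atMost using canonical_proc_cong by simp
  moreover have "canonical_proc (X \<omega>) i = X \<omega> i" for \<omega>
    unfolding X_def by (intro canonical_proc_cong proc_equiv_on_mono[OF canonical_proc_equiv]) simp
  ultimately have "(\<lambda>\<omega>. X \<omega> i) -` {s} \<inter> space P = Y -` (network_of ` Collect ?Q) \<inter> space P"
    by (subst vimage_edge_cylinder[of "Suc i"]) auto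
  then show "(\<lambda>\<omega>. X \<omega> i) -` {s} \<inter> space P \<in> sets P"
    using measurable_sets[OF Y_measurable edge_cylinder_in_sets[OF \<open>edge_cylinder (Suc i) ?Q\<close>]] by simp
qed auto

lemma edge_cylinder_event:
  assumes "edge_cylinder n Q"
  shows "{\<omega> \<in> space P. Q (X \<omega> \<circ> j)} \<in> sets P"
proof -
  have "{\<omega> \<in> space P. Q (X \<omega> \<circ> j)} =
      (\<Union>t\<in>cylinder_prefixes n Q. {\<omega> \<in> space P. \<forall>i<n. X \<omega> (j i) = t i})"
    by (subst edge_cylinder_eq_Union[OF assms]) auto
  moreover have "{\<omega> \<in> space P. \<forall>i<n. X \<omega> (j i) = t i} \<in> sets P" for t
    by measurable
  ultimately show ?thesis
    by (auto intro!: sets.countable_UN' countable_cylinder_prefixes)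
qed

lemma network_of_reindex_measurable: "(\<lambda>\<omega>. network_of (X \<omega> \<circ> j)) \<in> P \<rightarrow>\<^sub>M network_measure"
proof (rule measurable_sigma_sets[OF sets_network_measure_cylinders edge_cylinder_sets_subset])
  fix A assume "A \<in> edge_cylinder_sets"
  then obtain n Q where A: "A = network_of ` Collect Q" "edge_cylinder n Q"
    unfolding edge_cylinder_sets_def by blast
  have "(\<lambda>\<omega>. network_of (X \<omega> \<circ> j)) -` A \<inter> space P = {\<omega> \<in> space P. Q (X \<omega> \<circ> j)}"
    unfolding A(1) using network_of_mem_image_iff[OF A(2)] by auto
  then show "(\<lambda>\<omega>. network_of (X \<omega> \<circ> j)) -` A \<inter> space P \<in> sets P"
    using edge_cylinder_event[OF A(2)] by simp
qed (auto simp: networks_def)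

text \<open>The form of exchangeability used from here on: \<open>j\<close> is extended to a
  permutation, and \<open>Q\<close> sees only its values below \<open>n\<close>.\<close>

lemma emeasure_reindex:
  assumes Q: "edge_cylinder n Q" and j: "inj_on j {..<n}"
  shows "emeasure P {\<omega> \<in> space P. Q (X \<omega> \<circ> j)} = emeasure P {\<omega> \<in> space P. Q (X \<omega>)}"
proof -
  obtain \<sigma> where \<sigma>: "bij \<sigma>" "\<And>i. i < n \<Longrightarrow> \<sigma> i = j i"
    using ex_bij_extension[OF j] by auto
  let ?A = "network_of ` Collect Q"
  have A: "?A \<in> sets network_measure" by (rule edge_cylinder_in_sets[OF Q])
  have "emeasure P {\<omega> \<in> space P. Q (X \<omega> \<circ> j)} = emeasure P {\<omega> \<in> space P. Q (X \<omega> \<circ> \<sigma>)}"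
    using edge_cylinder_cong[OF Q, of "X \<omega> \<circ> j" "X \<omega> \<circ> \<sigma>" for \<omega>] \<sigma>(2)
    by (intro arg_cong[of _ _ "emeasure P"]) auto
  also have "\<dots> = emeasure (distr P network_measure (\<lambda>\<omega>. network_of (X \<omega> \<circ> \<sigma>))) ?A"
    using network_of_mem_image_iff[OF Q]
    by (subst emeasure_distr[OF network_of_reindex_measurable A])
       (auto intro!: arg_cong[of _ _ "emeasure P"])
  \<comment> \<open>\<open>net_relabel\<close> composes with the inverse permutation, hence
    \<open>inv \<sigma>\<close>.\<close>
  also have "distr P network_measure (\<lambda>\<omega>. network_of (X \<omega> \<circ> \<sigma>))
      = distr P network_measure (\<lambda>\<omega>. net_relabel (inv \<sigma>) (Y \<omega>))"
    using \<sigma>(1) by (intro distr_cong)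
      (auto simp: net_relabel_network_of bij_imp_bij_inv inv_inv_eq simp flip: network_of_X)
  also have "\<dots> = distr P network_measure Y"
    using exchangeable bij_imp_bij_inv[OF \<sigma>(1)] unfolding edge_exchangeable_def by blast
  also have "emeasure \<dots> ?A = emeasure P {\<omega> \<in> space P. Q (X \<omega>)}"
    by (subst emeasure_distr[OF Y_measurable A]) (simp add: vimage_edge_cylinder[OF Q])
  finally show ?thesis .
qed

lemma prob_reindex:
  assumes "edge_cylinder n Q" "inj_on j {..<n}"
  shows "prob {\<omega> \<in> space P. Q (X \<omega> \<circ> j)} = prob {\<omega> \<in> space P. Q (X \<omega>)}"
  using emeasure_reindex[OF assms] by (simp add: measure_def)

lemma freq_measurable [measurable]: "(\<lambda>\<omega>. freq k (X \<omega>) s) \<in> borel_measurable P"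
  unfolding freq_eq by measurable

lemma freq_edge_measurable [measurable]: "(\<lambda>\<omega>. freq k (X \<omega>) (X \<omega> i)) \<in> borel_measurable P"
  unfolding freq_eq by measurable

section \<open>Almost sure convergence of the window frequencies\<close>

text \<open>The frequency is that of the interaction at edge \<open>i\<close>, since only
  coincidences of edges are invariant under reindexing. As \<open>i\<close> lies in neither window,
  the coincidence indicators have constant correlations off the diagonal, and the difference of
  frequencies weights them with total 0.\<close>

lemma expectation_freq_diff_square:
  assumes "i \<le> k"
  shows "expectation (\<lambda>\<omega>. (freq (Suc k) (X \<omega>) (X \<omega> i) - freq k (X \<omega>) (X \<omega> i))\<^sup>2) \<le> 2 / 4 ^ k"
proof -
  let ?U = "window k \<union> window (Suc k)"
  define Z :: "nat \<Rightarrow> 'a \<Rightarrow> real" where "Z j \<omega> = of_bool (X \<omega> j = X \<omega> i)" for j \<omega>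
  define c :: "nat \<Rightarrow> real" where "c j = (if j \<in> window k then - 1 / 4 ^ k else 1 / 4 ^ Suc k)" for j
  \<comment> \<open>Edges 0, 1 and 2 stand in for \<open>i\<close> and one or two distinct window
    edges.\<close>
  define p where "p = prob {\<omega> \<in> space P. X \<omega> 1 = X \<omega> 0}"
  define q where "q = prob {\<omega> \<in> space P. X \<omega> 1 = X \<omega> 0 \<and> X \<omega> 2 = X \<omega> 0}"
  have disj: "window k \<inter> window (Suc k) = {}" by (rule window_disjoint) simp
  have gt: "i < j" if "j \<in> ?U" for j
    using that less_window[of i k j] less_window[of i "Suc k" j] assms by auto
  have sum_U: "(\<Sum>j\<in>?U. g j) = (\<Sum>j\<in>window k. g j) + (\<Sum>j\<in>window (Suc k). g j)" for g :: "nat \<Rightarrow> real"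
    by (rule sum.union_disjoint) (use disj in auto)
  have c1: "c j = - 1 / 4 ^ k" if "j \<in> window k" for j using that by (simp add: c_def)
  have c2: "c j = 1 / 4 ^ Suc k" if "j \<in> window (Suc k)" for j using that disj by (auto simp: c_def)
  have corr: "expectation (\<lambda>\<omega>. Z j \<omega> * Z l \<omega>) = q + (if j = l then p - q else 0)"
    if jl: "j \<in> ?U" "l \<in> ?U" for j l
  proof (cases "j = l")
    case True
    have "expectation (\<lambda>\<omega>. Z j \<omega> * Z j \<omega>) = expectation (indicator {\<omega> \<in> space P. X \<omega> j = X \<omega> i})"
      by (intro Bochner_Integration.integral_cong) (auto simp: Z_def indicator_def)
    also have "\<dots> = prob {\<omega> \<in> space P. X \<omega> j = X \<omega> i}" by simp
    also have "\<dots> = p"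
    proof -
      let ?j = "\<lambda>m :: nat. if m = 0 then i else j"
      have "edge_cylinder 2 (\<lambda>I. I 1 = I 0)"
        unfolding edge_cylinder_def by (auto intro: proc_equiv_on_same_edge)
      moreover have "inj_on ?j {..<2}"
        using gt[OF jl(1)] by (auto simp: inj_on_def)
      ultimately show ?thesis unfolding p_def using prob_reindex[of 2 "\<lambda>I. I 1 = I 0" ?j] by simp
    qed
    finally show ?thesis using True by simp
  next
    case False
    have "expectation (\<lambda>\<omega>. Z j \<omega> * Z l \<omega>) =
        expectation (indicator {\<omega> \<in> space P. X \<omega> j = X \<omega> i \<and> X \<omega> l = X \<omega> i})"
      by (intro Bochner_Integration.integral_cong) (auto simp: Z_def indicator_def)
    also have "\<dots> = prob {\<omega> \<in> space P. X \<omega> j = X \<omega> i \<and> X \<omega> l = X \<omega> i}" by simp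
    also have "\<dots> = q"
    proof -
      let ?j = "\<lambda>m :: nat. if m = 0 then i else if m = 1 then j else l"
      have "edge_cylinder 3 (\<lambda>I. I 1 = I 0 \<and> I 2 = I 0)"
        unfolding edge_cylinder_def by (auto intro: proc_equiv_on_same_edge)
      moreover have "inj_on ?j {..<3}"
        using gt[OF jl(1)] gt[OF jl(2)] False by (auto simp: inj_on_def)
      ultimately show ?thesis unfolding q_def using prob_reindex[of 3 "\<lambda>I. I 1 = I 0 \<and> I 2 = I 0" ?j] by simp
    qed
    finally show ?thesis using False by simp
  qed
  have diff: "freq (Suc k) (X \<omega>) (X \<omega> i) - freq k (X \<omega>) (X \<omega> i) = (\<Sum>j\<in>?U. c j * Z j \<omega>)" for \<omega>
    unfolding sum_U freq_eq by (simp add: c1 c2 Z_def sum_divide_distrib sum_negf del: sum_of_bool_eq)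
  have "expectation (\<lambda>\<omega>. (\<Sum>j\<in>?U. c j * Z j \<omega>)\<^sup>2) = (p - q) * (\<Sum>j\<in>?U. (c j)\<^sup>2)"
  proof (rule expectation_square_weighted_sum[OF _ _ _ corr])
    show "Z j \<in> borel_measurable P" for j unfolding Z_def by measurable
    show "(\<Sum>j\<in>?U. c j) = 0" unfolding sum_U by (simp add: c1 c2)
  qed (auto simp: Z_def)
  also have "(\<Sum>j\<in>?U. (c j)\<^sup>2) = 1 / 4 ^ k + 1 / 4 ^ Suc k"
    unfolding sum_U by (simp add: c1 c2 power2_eq_square)
  also have "(p - q) * (1 / 4 ^ k + 1 / 4 ^ Suc k) \<le> 1 * (1 / 4 ^ k + 1 / 4 ^ Suc k)"
    unfolding p_def q_def by (intro mult_right_mono) (smt (verit) measure_nonneg prob_le_1, simp)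
  also have "\<dots> \<le> 2 / 4 ^ k" by (simp add: field_simps)
  finally show ?thesis unfolding diff .
qed

text \<open>The second moment bound makes the first moments of the increments summable. The
  increments are then almost surely absolutely summable, and telescoping gives convergence.\<close>

lemma AE_convergent_freq_edge: "AE \<omega> in P. convergent (\<lambda>k. freq k (X \<omega>) (X \<omega> i))"
proof -
  \<comment> \<open>The shift by \<open>i\<close> meets the condition that \<open>i\<close> be at
    most the window index.\<close>
  define D where "D k \<omega> = freq (Suc (k + i)) (X \<omega>) (X \<omega> i) - freq (k + i) (X \<omega>) (X \<omega> i)" for k \<omega>
  have D_meas [measurable]: "D k \<in> borel_measurable P" for k unfolding D_def by measurable
  have D_le: "\<bar>D k \<omega>\<bar> \<le> 1" for k \<omega>
    unfolding D_def freq_def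
    using pmf_le_1[of "map_pmf (X \<omega>) (pmf_of_set (window (Suc (k + i))))" "X \<omega> i"]
      pmf_le_1[of "map_pmf (X \<omega>) (pmf_of_set (window (k + i)))" "X \<omega> i"]
      pmf_nonneg[of "map_pmf (X \<omega>) (pmf_of_set (window (Suc (k + i))))" "X \<omega> i"]
      pmf_nonneg[of "map_pmf (X \<omega>) (pmf_of_set (window (k + i)))" "X \<omega> i"]
    by linarith
  have int: "integrable P (\<lambda>\<omega>. \<bar>D k \<omega>\<bar>)" "integrable P (\<lambda>\<omega>. (D k \<omega>)\<^sup>2)" for k
    using D_le by (auto intro!: integrable_const_bound[of _ 1] AE_I2 simp: abs_square_le_1)
  have bound: "(\<integral>\<^sup>+\<omega>. ennreal \<bar>D k \<omega>\<bar> \<partial>P) \<le> ennreal (2 * (1/2) ^ k)" for k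
  proof -
    let ?c = "2 ^ (k + i) :: real"
    \<comment> \<open>The inequality of arithmetic and geometric means. The weight \<open>?c\<close>
      balances the two terms, as the expected square is at most \<open>2 / ?c ^ 2\<close>.\<close>
    have "2 * \<bar>D k \<omega>\<bar> \<le> 1 / ?c + ?c * (D k \<omega>)\<^sup>2" for \<omega>
    proof -
      have "0 \<le> (1 - ?c * \<bar>D k \<omega>\<bar>)\<^sup>2 / ?c" by simp
      also have "\<dots> = 1 / ?c + ?c * (D k \<omega>)\<^sup>2 - 2 * \<bar>D k \<omega>\<bar>"
        by (simp add: field_simps power2_eq_square)
      finally show ?thesis by simp
    qed
    then have "expectation (\<lambda>\<omega>. 2 * \<bar>D k \<omega>\<bar>) \<le> expectation (\<lambda>\<omega>. 1 / ?c + ?c * (D k \<omega>)\<^sup>2)"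
      using int by (intro integral_mono) auto
    then have "2 * expectation (\<lambda>\<omega>. \<bar>D k \<omega>\<bar>) \<le> 1 / ?c + ?c * expectation (\<lambda>\<omega>. (D k \<omega>)\<^sup>2)"
      using int by (simp add: prob_space)
    also have "\<dots> \<le> 1 / ?c + ?c * (2 / 4 ^ (k + i))"
      unfolding D_def using expectation_freq_diff_square[of i "k + i"]
      by (intro add_left_mono mult_left_mono) auto
    also have "\<dots> = 3 / ?c"
    proof -
      have "(4::real) ^ (k + i) = ?c * ?c" by (simp flip: power_mult_distrib)
      then show ?thesis by simp
    qed
    also have "\<dots> \<le> 3 / 2 ^ k"
      by (intro divide_left_mono power_increasing) auto
    finally have "expectation (\<lambda>\<omega>. \<bar>D k \<omega>\<bar>) \<le> 2 * (1/2) ^ k"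
      by (simp add: power_one_over field_simps)
    then show ?thesis
      using int(1) by (subst nn_integral_eq_integral) (auto intro: ennreal_leI)
  qed
  have "(\<integral>\<^sup>+\<omega>. (\<Sum>k. ennreal \<bar>D k \<omega>\<bar>) \<partial>P) = (\<Sum>k. \<integral>\<^sup>+\<omega>. ennreal \<bar>D k \<omega>\<bar> \<partial>P)"
    by (rule nn_integral_suminf) measurable
  also have "\<dots> \<le> (\<Sum>k. ennreal (2 * (1/2) ^ k))"
    using bound by (intro suminf_le) auto
  also have "\<dots> = ennreal (\<Sum>k. 2 * (1/2) ^ k)"
    by (rule suminf_ennreal2) (auto intro: summable_mult summable_geometric)
  finally have "(\<integral>\<^sup>+\<omega>. (\<Sum>k. ennreal \<bar>D k \<omega>\<bar>) \<partial>P) \<noteq> \<infinity>"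
    using ennreal_less_top le_less_trans by (metis infinity_ennreal_def less_irrefl)
  then have "AE \<omega> in P. (\<Sum>k. ennreal \<bar>D k \<omega>\<bar>) \<noteq> \<infinity>"
    by (intro nn_integral_PInf_AE) measurable
  then show ?thesis
  proof eventually_elim
    case (elim \<omega>)
    then have "summable (\<lambda>k. \<bar>D k \<omega>\<bar>)"
      by (intro summable_suminf_not_top) auto
    then have "summable (\<lambda>k. D k \<omega>)" by (rule summable_rabs_cancel)
    then have "convergent (\<lambda>n. \<Sum>k<n. D k \<omega>)" by (simp add: summable_iff_convergent)
    moreover have "(\<Sum>k<n. D k \<omega>) = freq (n + i) (X \<omega>) (X \<omega> i) - freq i (X \<omega>) (X \<omega> i)" for n
      unfolding D_def using sum_lessThan_telescope[of "\<lambda>k. freq (k + i) (X \<omega>) (X \<omega> i)" n] by simp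
    ultimately have "convergent (\<lambda>n. freq (n + i) (X \<omega>) (X \<omega> i))"
      by (simp add: convergent_diff_const_right_iff)
    then show ?case by (simp add: convergent_ignore_initial_segment[of "\<lambda>n. freq n (X \<omega>) (X \<omega> i)"])
  qed
qed

definition limit_freq :: "'a \<Rightarrow> nat list \<Rightarrow> real" where
  "limit_freq \<omega> s = lim (\<lambda>k. freq k (X \<omega>) s)"

lemma limit_freq_measurable [measurable]: "(\<lambda>\<omega>. limit_freq \<omega> s) \<in> borel_measurable P"
  unfolding limit_freq_def by measurable

text \<open>An interaction that occurs is the value at one of countably many edges; one that never
  occurs has frequency 0.\<close>

lemma AE_freq_tendsto: "AE \<omega> in P. \<forall>s. (\<lambda>k. freq k (X \<omega>) s) \<longlonglongrightarrow> limit_freq \<omega> s"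
proof -
  have "AE \<omega> in P. \<forall>i. convergent (\<lambda>k. freq k (X \<omega>) (X \<omega> i))"
    using AE_convergent_freq_edge by (simp add: AE_all_countable)
  then show ?thesis
  proof eventually_elim
    case (elim \<omega>)
    have "convergent (\<lambda>k. freq k (X \<omega>) s)" for s
    proof (cases "s \<in> range (X \<omega>)")
      case True
      then show ?thesis using elim by auto
    next
      case False
      then have "freq k (X \<omega>) s = 0" for k
        unfolding freq_eq by (auto intro!: sum.neutral)
      then show ?thesis by (simp add: convergent_const)
    qed
    then show ?case by (simp add: limit_freq_def convergent_LIMSEQ_iff)
  qed
qed

section \<open>Total mass of the limiting frequencies\<close>

text \<open>The events increase to the recurrence of edge 0, which is almost sure. The absence of
  blips enters the proof here.\<close>

lemma prob_first_edge_repeated: 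
  "(\<lambda>K. prob {\<omega> \<in> space P. X \<omega> 0 \<in> X \<omega> ` {1..K}}) \<longlonglongrightarrow> 1"
proof -
  let ?A = "\<lambda>K. {\<omega> \<in> space P. X \<omega> 0 \<in> X \<omega> ` {1..K}}"
  have meas: "?A K \<in> events" for K
    unfolding image_iff by measurable
  have "(\<lambda>K. prob (?A K)) \<longlonglongrightarrow> prob (\<Union>K. ?A K)"
    by (rule finite_Lim_measure_incseq) (use meas in \<open>auto simp: incseq_def\<close>)
  moreover have "prob (\<Union>K. ?A K) = 1"
  proof (rule prob_eq_1[THEN iffD2])
    show "(\<Union>K. ?A K) \<in> events" using meas by auto
    have "AE \<omega> in P. \<omega> \<in> space P \<and> blip_free_net (Y \<omega>)" using blip_free AE_space by eventually_elim simp
    then show "AE \<omega> in P. \<omega> \<in> (\<Union>K. ?A K)"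
    proof eventually_elim
      case (elim \<omega>)
      then have "blip_free_proc (X \<omega>)"
        using network_of_X[of \<omega>] mem_network_of_iff[of "X \<omega>" "X \<omega>"]
        unfolding blip_free_net_def by auto
      then obtain j where "j \<noteq> 0" "X \<omega> j = X \<omega> 0" unfolding blip_free_proc_def by blast
      then have "X \<omega> 0 \<in> X \<omega> ` {1..j}" by (metis atLeastAtMost_iff image_eqI less_one not_less order_refl)
      then show ?case using elim by blast
    qed
  qed
  ultimately show ?thesis by simp
qed

lemma prob_edge_seen_before:
  assumes "K \<le> j"
  shows "prob {\<omega> \<in> space P. X \<omega> j \<in> X \<omega> ` {..<K}} = prob {\<omega> \<in> space P. X \<omega> 0 \<in> X \<omega> ` {1..K}}"
proof -
  \<comment> \<open>Edge 0 is sent to \<open>j\<close> and the edges from 1 to \<open>K\<close> to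
    the first \<open>K\<close> edges; \<open>K \<le> j\<close> makes this injective.\<close>
  let ?j = "\<lambda>m. case m of 0 \<Rightarrow> j | Suc i \<Rightarrow> i"
  let ?Q = "\<lambda>I :: iproc. I 0 \<in> I ` {1..K}"
  have "edge_cylinder (Suc K) ?Q"
    unfolding edge_cylinder_def
  proof (intro allI impI)
    fix I J assume *: "proc_equiv_on {..<Suc K} I J" "?Q I"
    then obtain i where "i \<in> {1..K}" "I 0 = I i" by auto
    then have "J 0 = J i" by (intro proc_equiv_on_same_edge[OF *(1)]) auto
    then show "?Q J" using \<open>i \<in> {1..K}\<close> by auto
  qed
  moreover have "inj_on ?j {..<Suc K}"
    using assms by (auto simp: inj_on_def split: nat.splits)
  moreover have "?Q (X \<omega> \<circ> ?j) \<longleftrightarrow> X \<omega> j \<in> X \<omega> ` {..<K}" for \<omega>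
  proof -
    have "{1..K} = Suc ` {..<K}" by (simp add: image_Suc_lessThan)
    then show ?thesis by (simp add: image_image)
  qed
  ultimately show ?thesis using prob_reindex[of "Suc K" ?Q ?j] by simp
qed

text \<open>By Fatou's lemma the total limiting mass \<open>h\<close> is at most 1. The part of it
  on the interactions of the first \<open>K\<close> edges has expectation tending to 1, so
  \<open>h\<close> has expectation 1 and equals 1 almost surely.\<close>

lemma AE_limit_freq_F1: "AE \<omega> in P. limit_freq \<omega> \<in> F1"
proof -
  define h where "h \<omega> = (\<integral>\<^sup>+s. ennreal (limit_freq \<omega> s) \<partial>count_space UNIV)" for \<omega>
  have h_meas [measurable]: "h \<in> borel_measurable P"
    unfolding h_def by (intro borel_measurable_nn_integral_count_space) auto
  have nonneg: "AE \<omega> in P. \<forall>s. 0 \<le> limit_freq \<omega> s"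
    using AE_freq_tendsto
    by eventually_elim (meson LIMSEQ_le_const freq_nonneg)
  have h_le: "AE \<omega> in P. h \<omega> \<le> 1"
    using AE_freq_tendsto
  proof eventually_elim
    case (elim \<omega>)
    have "h \<omega> = (\<integral>\<^sup>+s. liminf (\<lambda>k. ennreal (freq k (X \<omega>) s)) \<partial>count_space UNIV)"
      unfolding h_def
    proof (rule nn_integral_cong)
      fix s
      have "(\<lambda>k. ennreal (freq k (X \<omega>) s)) \<longlonglongrightarrow> ennreal (limit_freq \<omega> s)"
        using elim by (intro tendsto_ennrealI) auto
      then show "ennreal (limit_freq \<omega> s) = liminf (\<lambda>k. ennreal (freq k (X \<omega>) s))"
        by (simp add: lim_imp_Liminf)
    qed
    also have "\<dots> \<le> liminf (\<lambda>k. \<integral>\<^sup>+s. ennreal (freq k (X \<omega>) s) \<partial>count_space UNIV)"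
      by (rule nn_integral_liminf) simp
    also have "\<dots> = 1" by (simp add: nn_integral_freq Liminf_const)
    finally show ?case .
  qed
  have lower: "ennreal (prob {\<omega> \<in> space P. X \<omega> 0 \<in> X \<omega> ` {1..K}}) \<le> (\<integral>\<^sup>+\<omega>. h \<omega> \<partial>P)" for K
  proof -
    let ?p = "prob {\<omega> \<in> space P. X \<omega> 0 \<in> X \<omega> ` {1..K}}"
    \<comment> \<open>The window frequency of a random but finite set of interactions: the limit in
      \<open>k\<close> passes through the sum, and exchangeability makes the expectation constant
      for \<open>K \<le> k\<close>.\<close>
    define S where "S k \<omega> = (\<Sum>s\<in>X \<omega> ` {..<K}. freq k (X \<omega>) s)" for k \<omega>
    define L where "L \<omega> = lim (\<lambda>k. S k \<omega>)" for \<omega>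
    have S_eq: "S k \<omega> = (\<Sum>j\<in>window k. of_bool (X \<omega> j \<in> X \<omega> ` {..<K})) / 4 ^ k" for k \<omega>
      unfolding S_def by (rule sum_freq_eq) simp
    have S_meas [measurable]: "S k \<in> borel_measurable P" for k
      unfolding S_eq image_iff by measurable
    have L_meas [measurable]: "L \<in> borel_measurable P" unfolding L_def by measurable
    have S_bd: "0 \<le> S k \<omega>" "S k \<omega> \<le> 1" for k \<omega>
    proof -
      show "0 \<le> S k \<omega>" unfolding S_def by (intro sum_nonneg freq_nonneg)
      have "(\<Sum>j\<in>window k. of_bool (X \<omega> j \<in> X \<omega> ` {..<K})) \<le> (\<Sum>j\<in>window k. 1 :: real)"
        by (intro sum_mono) auto
      then show "S k \<omega> \<le> 1" unfolding S_eq by simp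
    qed
    have lim: "AE \<omega> in P. (\<lambda>k. S k \<omega>) \<longlonglongrightarrow> L \<omega> \<and> ennreal (L \<omega>) \<le> h \<omega>"
      using AE_freq_tendsto nonneg
    proof eventually_elim
      case (elim \<omega>)
      have *: "(\<lambda>k. S k \<omega>) \<longlonglongrightarrow> (\<Sum>s\<in>X \<omega> ` {..<K}. limit_freq \<omega> s)"
        unfolding S_def using elim by (intro tendsto_sum) auto
      then have L: "L \<omega> = (\<Sum>s\<in>X \<omega> ` {..<K}. limit_freq \<omega> s)"
        unfolding L_def by (rule limI)
      have "ennreal (L \<omega>) = (\<integral>\<^sup>+s. ennreal (limit_freq \<omega> s) \<partial>count_space (X \<omega> ` {..<K}))"
        unfolding L using elim by (subst nn_integral_count_space_finite) auto
      also have "\<dots> \<le> h \<omega>"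
        unfolding h_def
        by (subst nn_integral_count_space_indicator) (auto intro!: nn_integral_mono simp: indicator_def)
      finally show ?case using * L by simp
    qed
    have "(\<lambda>k. expectation (S k)) \<longlonglongrightarrow> expectation L"
      using S_bd lim by (intro integral_dominated_convergence[where w="\<lambda>_. 1"]) auto
    moreover have "expectation (S k) = ?p" if "K \<le> k" for k
    proof -
      have "expectation (\<lambda>\<omega>. of_bool (X \<omega> j \<in> X \<omega> ` {..<K})) = ?p" if j: "j \<in> window k" for j
      proof -
        have "expectation (\<lambda>\<omega>. of_bool (X \<omega> j \<in> X \<omega> ` {..<K})) =
            expectation (indicator {\<omega> \<in> space P. X \<omega> j \<in> X \<omega> ` {..<K}})"
          by (intro Bochner_Integration.integral_cong) (auto simp: indicator_def)
        also have "\<dots> = prob {\<omega> \<in> space P. X \<omega> j \<in> X \<omega> ` {..<K}}"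
          by (simp add: Int_def conj_commute)
        finally show ?thesis
          using prob_edge_seen_before[of K j] less_window[OF \<open>K \<le> k\<close> j] by simp
      qed
      moreover have "integrable P (\<lambda>\<omega>. of_bool (X \<omega> j \<in> X \<omega> ` {..<K}) :: real)" for j
        unfolding image_iff by (intro integrable_const_bound[of _ 1]) auto
      ultimately show ?thesis unfolding S_eq
        by (simp add: Bochner_Integration.integral_sum del: sum_of_bool_eq)
    qed
    then have "(\<lambda>k. expectation (S k)) \<longlonglongrightarrow> ?p"
      by (intro tendsto_eventually) (auto simp: eventually_sequentially)
    ultimately have "?p = expectation L" by (rule LIMSEQ_unique[rotated])
    also have "ennreal (expectation L) = (\<integral>\<^sup>+\<omega>. ennreal (L \<omega>) \<partial>P)"
    proof (rule nn_integral_eq_integral[symmetric])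
      have "AE \<omega> in P. 0 \<le> L \<omega> \<and> L \<omega> \<le> 1"
        using lim by eventually_elim (meson LIMSEQ_le_const LIMSEQ_le_const2 S_bd)
      then show "integrable P L" "AE \<omega> in P. 0 \<le> L \<omega>"
        by (auto intro!: integrable_const_bound[of _ 1])
    qed
    also have "\<dots> \<le> (\<integral>\<^sup>+\<omega>. h \<omega> \<partial>P)"
      using lim by (intro nn_integral_mono_AE) auto
    finally show ?thesis .
  qed
  have "1 \<le> (\<integral>\<^sup>+\<omega>. h \<omega> \<partial>P)"
    by (rule LIMSEQ_le_const2[where X="\<lambda>K. ennreal (prob {\<omega> \<in> space P. X \<omega> 0 \<in> X \<omega> ` {1..K}})"])
       (use lower tendsto_ennrealI[OF prob_first_edge_repeated] in auto)
  moreover have "(\<integral>\<^sup>+\<omega>. h \<omega> \<partial>P) \<le> 1"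
    using nn_integral_mono_AE[OF h_le] by (simp add: emeasure_space_1)
  ultimately have h_int: "(\<integral>\<^sup>+\<omega>. h \<omega> \<partial>P) = 1" by simp
  \<comment> \<open>The deficit \<open>1 - h\<close> is truncated at 0, so its vanishing gives only
    \<open>1 \<le> h\<close>; \<open>h_le\<close> provides the other half.\<close>
  have "(\<integral>\<^sup>+\<omega>. 1 - h \<omega> \<partial>P) = 0"
    using h_int h_le by (subst nn_integral_diff) (auto simp: emeasure_space_1)
  then have "AE \<omega> in P. 1 - h \<omega> = 0"
    by (subst (asm) nn_integral_0_iff_AE) auto
  with h_le nonneg show ?thesis
  proof eventually_elim
    case (elim \<omega>)
    then have "h \<omega> = 1" by (intro antisym) (auto simp: diff_eq_0_iff_ennreal)
    then show ?case using elim by (simp add: F1_iff h_def)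
  qed
qed

section \<open>The mixture formula\<close>

text \<open>A separate window for each of the \<open>n\<close> positions makes the sampled edges
  always distinct, so that every tuple in \<open>?J\<close> contributes exactly the probability of
  \<open>Q\<close> and no correction for repetitions arises.\<close>

lemma nn_integral_prod_freq:
  assumes Q: "edge_cylinder n Q"
  shows "(\<integral>\<^sup>+\<omega>. \<integral>\<^sup>+t. (\<Prod>i<n. ennreal (freq (k + i) (X \<omega>) (t i))) \<partial>count_space (cylinder_prefixes n Q) \<partial>P)
    = emeasure P {\<omega> \<in> space P. Q (X \<omega>)}"
proof -
  let ?T = "cylinder_prefixes n Q"
  let ?J = "PiE {..<n} (\<lambda>i. window (k + i))"
  \<comment> \<open>The uniform weight of a tuple, the reciprocal of \<open>card ?J\<close>.\<close>
  define c :: real where "c = (\<Prod>i<n. 1 / 4 ^ (k + i))"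
  have c: "0 \<le> c" by (simp add: c_def prod_nonneg)
  have finJ: "finite ?J" by (intro finite_PiE) auto
  have prod_eq: "(\<Prod>i<n. ennreal (freq (k + i) I (t i))) =
      (\<Sum>j\<in>?J. ennreal c * indicator {restrict (I \<circ> j) {..<n}} t)"
    if t: "t \<in> ?T" for I t
  proof -
    have restr: "(\<Prod>i<n. of_bool (I (j i) = t i)) = (indicator {restrict (I \<circ> j) {..<n}} t :: real)" for j
    proof (cases "\<forall>i<n. I (j i) = t i")
      case True
      then have "t = restrict (I \<circ> j) {..<n}"
        using t by (auto simp: cylinder_prefixes_def PiE_iff extensional_def fun_eq_iff)
      then show ?thesis using True by simp
    next
      case False
      then have "t \<noteq> restrict (I \<circ> j) {..<n}" by auto
      moreover have "(\<Prod>i<n. of_bool (I (j i) = t i)) = (0 :: real)"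
        using False by (auto intro!: prod_zero)
      ultimately show ?thesis by simp
    qed
    have "(\<Prod>i<n. freq (k + i) I (t i)) = c * (\<Prod>i<n. \<Sum>j\<in>window (k + i). of_bool (I j = t i))"
      unfolding freq_eq c_def by (simp add: prod_dividef)
    also have "\<dots> = (\<Sum>j\<in>?J. c * (\<Prod>i<n. of_bool (I (j i) = t i)))"
      by (subst prod_sum_PiE) (auto simp: sum_distrib_left)
    finally have "(\<Prod>i<n. freq (k + i) I (t i)) = (\<Sum>j\<in>?J. c * indicator {restrict (I \<circ> j) {..<n}} t)"
      unfolding restr .
    then have "ennreal (\<Prod>i<n. freq (k + i) I (t i)) = (\<Sum>j\<in>?J. ennreal (c * indicator {restrict (I \<circ> j) {..<n}} t))"
      using c by (simp add: sum_ennreal)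
    then show ?thesis
      using c by (simp add: prod_ennreal freq_nonneg ennreal_mult ennreal_indicator)
  qed
  have "(\<integral>\<^sup>+t. (\<Prod>i<n. ennreal (freq (k + i) I (t i))) \<partial>count_space ?T) =
      (\<Sum>j\<in>?J. ennreal c * indicator {I. Q (I \<circ> j)} I)" for I
  proof -
    have "(\<integral>\<^sup>+t. (\<Prod>i<n. ennreal (freq (k + i) I (t i))) \<partial>count_space ?T) =
        (\<integral>\<^sup>+t. (\<Sum>j\<in>?J. ennreal c * indicator {restrict (I \<circ> j) {..<n}} t) \<partial>count_space ?T)"
      by (rule nn_integral_cong) (simp add: prod_eq)
    also have "\<dots> = (\<Sum>j\<in>?J. ennreal c * (\<integral>\<^sup>+t. indicator {restrict (I \<circ> j) {..<n}} t \<partial>count_space ?T))"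
      by (simp add: nn_integral_sum nn_integral_cmult)
    also have "\<dots> = (\<Sum>j\<in>?J. ennreal c * indicator {I. Q (I \<circ> j)} I)"
    proof (intro sum.cong refl arg_cong2[of _ _ _ _ "(*)"])
      fix j
      have "(\<integral>\<^sup>+t. indicator {restrict (I \<circ> j) {..<n}} t \<partial>count_space ?T)
          = (\<integral>\<^sup>+t. indicator ({restrict (I \<circ> j) {..<n}} \<inter> ?T) t \<partial>count_space ?T)"
        by (intro nn_integral_cong) (auto simp: indicator_def)
      also have "\<dots> = emeasure (count_space ?T) ({restrict (I \<circ> j) {..<n}} \<inter> ?T)"
        by (rule nn_integral_indicator) simp
      also have "\<dots> = indicator {I. Q (I \<circ> j)} I"
        using restrict_mem_cylinder_prefixes_iff[OF Q, of "I \<circ> j"]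
        by (cases "Q (I \<circ> j)") auto
      finally show "(\<integral>\<^sup>+t. indicator {restrict (I \<circ> j) {..<n}} t \<partial>count_space ?T) =
        (indicator {I. Q (I \<circ> j)} I :: ennreal)" .
    qed
    finally show ?thesis .
  qed
  then have "(\<integral>\<^sup>+\<omega>. \<integral>\<^sup>+t. (\<Prod>i<n. ennreal (freq (k + i) (X \<omega>) (t i))) \<partial>count_space ?T \<partial>P)
      = (\<integral>\<^sup>+\<omega>. (\<Sum>j\<in>?J. ennreal c * indicator {\<omega> \<in> space P. Q (X \<omega> \<circ> j)} \<omega>) \<partial>P)"
    by (intro nn_integral_cong) (auto simp: indicator_def intro!: sum.cong)
  also have "\<dots> = (\<Sum>j\<in>?J. ennreal c * emeasure P {\<omega> \<in> space P. Q (X \<omega> \<circ> j)})"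
    using edge_cylinder_event[OF Q]
    by (subst nn_integral_sum) (auto simp: nn_integral_cmult_indicator)
  also have "\<dots> = (\<Sum>j\<in>?J. ennreal c * emeasure P {\<omega> \<in> space P. Q (X \<omega>)})"
  proof (intro sum.cong refl arg_cong2[of _ _ _ _ "(*)"] emeasure_reindex[OF Q] inj_onI)
    fix j i i' assume j: "j \<in> ?J" and i: "i \<in> {..<n}" "i' \<in> {..<n}" and eq: "j i = j i'"
    have "j i \<in> window (k + i)" "j i' \<in> window (k + i')" using j i by auto
    then show "i = i'"
      using eq window_disjoint[of "k + i" "k + i'"] window_disjoint[of "k + i'" "k + i"]
      by (cases i i' rule: linorder_cases) auto
  qed
  also have "\<dots> = ennreal (real (card ?J) * c) * emeasure P {\<omega> \<in> space P. Q (X \<omega>)}"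
    using c by (simp add: ennreal_mult ennreal_of_nat_eq_real_of_nat mult.assoc)
  also have "real (card ?J) * c = 1"
    by (simp add: card_PiE c_def prod_dividef)
  finally show ?thesis by simp
qed

text \<open>Fatou's lemma is applied twice, over prefixes for fixed \<open>\<omega>\<close> and then
  over \<open>P\<close>; the expectations before the limit do not depend on
  \<open>k\<close>.\<close>

lemma nn_integral_prod_limit_freq_le:
  assumes Q: "edge_cylinder n Q"
  shows "(\<integral>\<^sup>+\<omega>. \<integral>\<^sup>+t. (\<Prod>i<n. ennreal (limit_freq \<omega> (t i))) \<partial>count_space (cylinder_prefixes n Q) \<partial>P)
    \<le> emeasure P {\<omega> \<in> space P. Q (X \<omega>)}"
proof -
  let ?T = "count_space (cylinder_prefixes n Q)"
  let ?u = "\<lambda>k \<omega>. \<integral>\<^sup>+t. (\<Prod>i<n. ennreal (freq (k + i) (X \<omega>) (t i))) \<partial>?T"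
  have "AE \<omega> in P. (\<integral>\<^sup>+t. (\<Prod>i<n. ennreal (limit_freq \<omega> (t i))) \<partial>?T) \<le> liminf (\<lambda>k. ?u k \<omega>)"
    using AE_freq_tendsto
  proof eventually_elim
    case (elim \<omega>)
    have "(\<integral>\<^sup>+t. (\<Prod>i<n. ennreal (limit_freq \<omega> (t i))) \<partial>?T) =
        (\<integral>\<^sup>+t. liminf (\<lambda>k. \<Prod>i<n. ennreal (freq (k + i) (X \<omega>) (t i))) \<partial>?T)"
    proof (rule nn_integral_cong)
      fix t
      have "(\<lambda>k. ennreal (\<Prod>i<n. freq (k + i) (X \<omega>) (t i))) \<longlonglongrightarrow> ennreal (\<Prod>i<n. limit_freq \<omega> (t i))"
        using elim by (intro tendsto_ennrealI tendsto_prod LIMSEQ_ignore_initial_segment) auto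
      moreover have "0 \<le> limit_freq \<omega> s" for s
        using elim by (meson LIMSEQ_le_const freq_nonneg)
      ultimately have "(\<lambda>k. \<Prod>i<n. ennreal (freq (k + i) (X \<omega>) (t i))) \<longlonglongrightarrow> (\<Prod>i<n. ennreal (limit_freq \<omega> (t i)))"
        by (simp add: prod_ennreal freq_nonneg)
      then show "(\<Prod>i<n. ennreal (limit_freq \<omega> (t i))) = liminf (\<lambda>k. \<Prod>i<n. ennreal (freq (k + i) (X \<omega>) (t i)))"
        by (simp add: lim_imp_Liminf)
    qed
    also have "\<dots> \<le> liminf (\<lambda>k. ?u k \<omega>)"
      by (rule nn_integral_liminf) simp
    finally show ?case .
  qed
  then have "(\<integral>\<^sup>+\<omega>. \<integral>\<^sup>+t. (\<Prod>i<n. ennreal (limit_freq \<omega> (t i))) \<partial>?T \<partial>P) \<le> (\<integral>\<^sup>+\<omega>. liminf (\<lambda>k. ?u k \<omega>) \<partial>P)"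
    by (rule nn_integral_mono_AE)
  also have "\<dots> \<le> liminf (\<lambda>k. \<integral>\<^sup>+\<omega>. ?u k \<omega> \<partial>P)"
    by (intro nn_integral_liminf borel_measurable_nn_integral_count_space countable_cylinder_prefixes)
      measurable
  also have "\<dots> = emeasure P {\<omega> \<in> space P. Q (X \<omega>)}"
    by (simp add: nn_integral_prod_freq[OF Q] Liminf_const)
  finally show ?thesis .
qed

lemma distr_eq_eps_mix:
  "\<exists>\<phi>. prob_space \<phi> \<and> sets \<phi> = sets F1_measure \<and> distr P network_measure Y = eps_mix \<phi>"
proof -
  obtain N where N: "N \<in> null_sets P" "{\<omega> \<in> space P. limit_freq \<omega> \<notin> F1} \<subseteq> N"
    using AE_limit_freq_F1 by (auto simp: eventually_ae_filter)
  \<comment> \<open>The point mass at the empty interaction, a default on the null set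
    \<open>N\<close> that puts \<open>f\<close> in \<open>F1\<close> everywhere on
    \<open>space P\<close>.\<close>
  define f0 :: "nat list \<Rightarrow> real" where "f0 = pmf (return_pmf [])"
  define f where "f \<omega> = (if \<omega> \<in> N then f0 else limit_freq \<omega>)" for \<omega>
  have f0: "f0 \<in> F1" unfolding F1_iff f0_def by (intro conjI allI pmf_nonneg nn_integral_pmf_eq_1)
  have f_F1: "f \<omega> \<in> F1" if "\<omega> \<in> space P" for \<omega> using N(2) f0 that by (auto simp: f_def)
  have AE_f: "AE \<omega> in P. f \<omega> = limit_freq \<omega>"
    using AE_not_in[OF N(1)] by eventually_elim (simp add: f_def)
  have f_meas: "f \<in> P \<rightarrow>\<^sub>M F1_measure"
    unfolding F1_measure_def
  proof (rule measurable_restrict_space2)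
    have "(\<lambda>\<omega>. f \<omega> s) \<in> borel_measurable P" for s
    proof -
      have "(\<lambda>\<omega>. if \<omega> \<in> N then f0 s else limit_freq \<omega> s) \<in> borel_measurable P"
        using N(1) by (intro measurable_If_set) auto
      then show ?thesis by (simp add: f_def if_distrib[of "\<lambda>g. g s"])
    qed
    then show "f \<in> P \<rightarrow>\<^sub>M PiM UNIV (\<lambda>_. borel)"
      by (intro measurable_PiM_single') auto
  qed (use f_F1 in auto)
  define \<phi> where "\<phi> = distr P F1_measure f"
  have \<phi>: "prob_space \<phi>" "sets \<phi> = sets F1_measure"
    unfolding \<phi>_def using f_meas by (auto intro: prob_space_distr)
  interpret \<phi>: prob_space \<phi> by fact
  have eps_meas: "eps \<in> \<phi> \<rightarrow>\<^sub>M prob_algebra network_measure"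
    using eps_measurable \<phi>(2) by (simp cong: measurable_cong_sets)
  have \<phi>_space: "\<phi> \<in> space (prob_algebra \<phi>)"
    using \<phi>(1) by (simp add: space_prob_algebra)
  interpret B: prob_space "\<phi> \<bind> eps"
    using prob_space_bind'[OF \<phi>_space eps_meas] .
  have sets_B: "sets (\<phi> \<bind> eps) = sets network_measure"
    using sets_bind'[OF \<phi>_space eps_meas] .
  have space_B: "space (\<phi> \<bind> eps) = networks"
    using sets_eq_imp_space_eq[OF sets_B] by simp
  interpret D: prob_space "distr P network_measure Y"
    by (rule prob_space_distr[OF Y_measurable])
  have le: "emeasure (\<phi> \<bind> eps) (network_of ` Collect Q) \<le>
      emeasure (distr P network_measure Y) (network_of ` Collect Q)" if Q: "edge_cylinder n Q" for n Q
  proof -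
    let ?A = "network_of ` Collect Q"
    have A: "?A \<in> sets network_measure" by (rule edge_cylinder_in_sets[OF Q])
    have "emeasure (\<phi> \<bind> eps) ?A = (\<integral>\<^sup>+f. emeasure (eps f) ?A \<partial>\<phi>)"
      by (rule emeasure_bind_prob_algebra[OF \<phi>_space eps_meas A])
    also have "\<dots> = (\<integral>\<^sup>+\<omega>. emeasure (eps (f \<omega>)) ?A \<partial>P)"
      unfolding \<phi>_def using measurable_emeasure_kernel[OF measurable_prob_algebraD[OF eps_measurable] A]
      by (subst nn_integral_distr[OF f_meas]) auto
    also have "\<dots> = (\<integral>\<^sup>+\<omega>. \<integral>\<^sup>+t. (\<Prod>i<n. ennreal (f \<omega> (t i))) \<partial>count_space (cylinder_prefixes n Q) \<partial>P)"
      by (intro nn_integral_cong emeasure_eps_cylinder[OF Q] f_F1)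
    also have "\<dots> = (\<integral>\<^sup>+\<omega>. \<integral>\<^sup>+t. (\<Prod>i<n. ennreal (limit_freq \<omega> (t i))) \<partial>count_space (cylinder_prefixes n Q) \<partial>P)"
      using AE_f by (intro nn_integral_cong_AE) auto
    also have "\<dots> \<le> emeasure P {\<omega> \<in> space P. Q (X \<omega>)}"
      by (rule nn_integral_prod_limit_freq_le[OF Q])
    also have "\<dots> = emeasure (distr P network_measure Y) ?A"
      by (subst emeasure_distr[OF Y_measurable A]) (simp add: vimage_edge_cylinder[OF Q])
    finally show ?thesis .
  qed
  have eq: "emeasure (distr P network_measure Y) A = emeasure (\<phi> \<bind> eps) A"
    if A_mem: "A \<in> edge_cylinder_sets" for A
  proof -
    obtain n Q where A: "A = network_of ` Collect Q" and Q: "edge_cylinder n Q"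
      using A_mem unfolding edge_cylinder_sets_def by blast
    have A_sets: "A \<in> sets network_measure" unfolding A by (rule edge_cylinder_in_sets[OF Q])
    have compl: "network_of ` {I. \<not> Q I} = networks - A"
      unfolding A networks_def using network_of_mem_image_iff[OF Q] by auto
    have 1: "measure (\<phi> \<bind> eps) A \<le> measure (distr P network_measure Y) A"
      using le[OF Q] unfolding A[symmetric] by (simp add: B.emeasure_eq_measure D.emeasure_eq_measure)
    \<comment> \<open>The complement is again an edge cylinder and both measures have mass 1, so its
      bound reverses the inequality for \<open>A\<close>.\<close>
    have "measure (\<phi> \<bind> eps) (networks - A) \<le> measure (distr P network_measure Y) (networks - A)"
      using le[OF edge_cylinder_not[OF Q]] unfolding compl
      by (simp add: B.emeasure_eq_measure D.emeasure_eq_measure)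
    then have 2: "1 - measure (\<phi> \<bind> eps) A \<le> 1 - measure (distr P network_measure Y) A"
      using B.prob_compl[of A] D.prob_compl[of A] A_sets by (simp add: sets_B space_B)
    show ?thesis
      using 1 2 by (simp add: B.emeasure_eq_measure D.emeasure_eq_measure)
  qed
  \<comment> \<open>The whole space is itself a generator of finite measure, as the uniqueness
    theorem requires.\<close>
  have "edge_cylinder 0 (\<lambda>_. True)" by (simp add: edge_cylinder_def)
  then have "networks \<in> edge_cylinder_sets"
    unfolding edge_cylinder_sets_def networks_def by force
  then have "distr P network_measure Y = \<phi> \<bind> eps"
    using eq D.emeasure_space_1
    by (intro measure_eqI_generator_eq[OF Int_stable_edge_cylinder_sets edge_cylinder_sets_subset,
          where A="\<lambda>_. networks"])
       (auto simp: sets_B sets_network_measure_cylinders D.emeasure_eq_measure)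
  then show ?thesis using \<phi> eps_mix_eq_bind[OF \<phi>] by auto
qed

end

theorem theorem4p2:
  fixes P :: "'a measure" and Y :: "'a \<Rightarrow> network"
  assumes "prob_space P"
    and "Y \<in> measurable P network_measure"
    and "edge_exchangeable P Y"
    and "AE \<omega> in P. blip_free_net (Y \<omega>)"
  shows "\<exists>\<phi>. prob_space \<phi> \<and> sets \<phi> = sets F1_measure \<and>
             distr P network_measure Y = eps_mix \<phi>"
proof -
  interpret blip_free_exchangeable_network P Y
    using assms by (simp add: blip_free_exchangeable_network_def blip_free_exchangeable_network_axioms_def)
  show ?thesis by (rule distr_eq_eps_mix)
qed

end
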